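(* Let $k\in\mathbb{N}$ and let $G$ be a group acting faithfully on a set $A$. Let $s\in G$ be an element for which there is a sequence of subgroups $\langle s\rangle = H_0<H_1<\cdots<H_k<H_{k+1}=G$ together with elements $g_i\in H_{i+1}$ $(1\leq i\leq k)$ such that for every $1\leq i\leq k$: (i) every homomorphism from $H_i$ to the additive group $\mathbb{R}$ is trivial, and (ii) $g_i(\operatorname{supp}(H_i))\cap \operatorname{supp}(H_i)=\emptyset$ in $A$. Then for every complete CAT(0) space $X$ of topological dimension $k$ and every semi-simple action of $G$ on $X$, the element $s$ has a fixed point in $X$.
   Context: For a group $G$ acting on a set $A$, the support of $g\in G$ is $\operatorname{supp}(g)=\{a\in A\mid ga\neq a\}$, and the support of a subset $L\subset G$ is $\operatorname{supp}(L)=\bigcup_{l\in L}\operatorname{supp}(l)$. The notation $H<H'$ means that $H$ is a subgroup of $H'$. CAT(0) spaces are (non-empty) geodesic metric spaces whose geodesic triangles are no fatter than Euclidean comparison triangles. For an isometry $\gamma$ of a metric space $(X,d)$, its translation length is $|\gamma|=\inf\{d(x,\gamma(x))\mid x\in X\}$, and $\gamma$ is semi-simple if this infimum is attained at some point of $X$ (it is then called elliptic if $|\gamma|=0$, i.e. $\gamma$ has a fixed point, and hyperbolic if $|\gamma|>0$). An isometric action of a group on a metric space is semi-simple if every group element acts as a semi-simple isometry. "Dimension" means topological (covering) dimension. *)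

theory Defs
  imports
    "HOL-Analysis.Analysis"
    "HOL-Algebra.Group_Action"
    "HOL-Algebra.Generated_Groups"
begin

subsection \<open>Group actions\<close>

definition supp :: "'a set \<Rightarrow> ('g \<Rightarrow> 'a \<Rightarrow> 'a) \<Rightarrow> 'g \<Rightarrow> 'a set" where
  "supp A \<phi> g = {a \<in> A. \<phi> g a \<noteq> a}"

definition supp_set :: "'a set \<Rightarrow> ('g \<Rightarrow> 'a \<Rightarrow> 'a) \<Rightarrow> 'g set \<Rightarrow> 'a set" where
  "supp_set A \<phi> L = (\<Union>l\<in>L. supp A \<phi> l)"

definition real_group :: "real monoid" where
  "real_group = \<lparr>carrier = UNIV, monoid.mult = (+), one = 0\<rparr>"

subsection \<open>CAT(0) spaces\<close>

definition geodesic_path :: "'x set \<Rightarrow> ('x \<Rightarrow> 'x \<Rightarrow> real) \<Rightarrow> (real \<Rightarrow> 'x) \<Rightarrow> 'x \<Rightarrow> 'x \<Rightarrow> bool" where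
  "geodesic_path M d c x y \<longleftrightarrow>
     c ` {0..d x y} \<subseteq> M \<and> c 0 = x \<and> c (d x y) = y \<and>
     (\<forall>s\<in>{0..d x y}. \<forall>t\<in>{0..d x y}. d (c s) (c t) = \<bar>s - t\<bar>)"

definition geodesic_segment :: "'x set \<Rightarrow> ('x \<Rightarrow> 'x \<Rightarrow> real) \<Rightarrow> 'x \<Rightarrow> 'x \<Rightarrow> 'x set \<Rightarrow> bool" where
  "geodesic_segment M d x y S \<longleftrightarrow> (\<exists>c. geodesic_path M d c x y \<and> S = c ` {0..d x y})"

definition geodesic_space :: "'x set \<Rightarrow> ('x \<Rightarrow> 'x \<Rightarrow> real) \<Rightarrow> bool" where
  "geodesic_space M d \<longleftrightarrow>
     Metric_space M d \<and> (\<forall>x\<in>M. \<forall>y\<in>M. \<exists>S. geodesic_segment M d x y S)"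

text \<open>
  \<open>x'\<close> is a comparison point for \<open>x\<close>, where \<open>x\<close> lies on the geodesic triangle with
  vertices \<open>p\<close>, \<open>q\<close>, \<open>r\<close> and sides \<open>S1 = [p,q]\<close>, \<open>S2 = [q,r]\<close>, \<open>S3 = [r,p]\<close>, and the
  comparison triangle has vertices \<open>p'\<close>, \<open>q'\<close>, \<open>r'\<close>. It is a relation, since a point
  common to two sides can have two comparison points.
\<close>
definition comparison_point ::
  "('x \<Rightarrow> 'x \<Rightarrow> real) \<Rightarrow> 'x \<Rightarrow> 'x \<Rightarrow> 'x \<Rightarrow> 'x set \<Rightarrow> 'x set \<Rightarrow> 'x set \<Rightarrow>
   real^2 \<Rightarrow> real^2 \<Rightarrow> real^2 \<Rightarrow> 'x \<Rightarrow> real^2 \<Rightarrow> bool" where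
  "comparison_point d p q r S1 S2 S3 p' q' r' x x' \<longleftrightarrow>
     x \<in> S1 \<and> x' \<in> closed_segment p' q' \<and> dist p' x' = d p x \<or>
     x \<in> S2 \<and> x' \<in> closed_segment q' r' \<and> dist q' x' = d q x \<or>
     x \<in> S3 \<and> x' \<in> closed_segment r' p' \<and> dist r' x' = d r x"

definition CAT0_space :: "'x set \<Rightarrow> ('x \<Rightarrow> 'x \<Rightarrow> real) \<Rightarrow> bool" where
  "CAT0_space M d \<longleftrightarrow>
     M \<noteq> {} \<and> geodesic_space M d \<and>
     (\<forall>p\<in>M. \<forall>q\<in>M. \<forall>r\<in>M. \<forall>S1 S2 S3. \<forall>p' q' r'.
        geodesic_segment M d p q S1 \<and> geodesic_segment M d q r S2 \<and> geodesic_segment M d r p S3 \<and>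
        dist p' q' = d p q \<and> dist q' r' = d q r \<and> dist r' p' = d r p \<longrightarrow>
        (\<forall>x y x' y'.
           comparison_point d p q r S1 S2 S3 p' q' r' x x' \<and>
           comparison_point d p q r S1 S2 S3 p' q' r' y y' \<longrightarrow>
           d x y \<le> dist x' y'))"

subsection \<open>Covering dimension\<close>

definition open_cover :: "'x topology \<Rightarrow> 'x set set \<Rightarrow> bool" where
  "open_cover T \<U> \<longleftrightarrow> (\<forall>U\<in>\<U>. openin T U) \<and> \<Union>\<U> = topspace T"

definition covering_dim_le :: "'x topology \<Rightarrow> nat \<Rightarrow> bool" where
  "covering_dim_le T n \<longleftrightarrow>
     (\<forall>\<U>. open_cover T \<U> \<longrightarrow>
        (\<exists>\<V>. open_cover T \<V> \<and> (\<forall>V\<in>\<V>. \<exists>U\<in>\<U>. V \<subseteq> U) \<and>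
             (\<forall>x\<in>topspace T. finite {V\<in>\<V>. x \<in> V} \<and> card {V\<in>\<V>. x \<in> V} \<le> n + 1)))"

text \<open>
  The value is \<open>\<infinity>\<close> if no bound exists. The empty space gets dimension \<open>0\<close> rather than
  the usual \<open>-1\<close>; CAT(0) spaces are non-empty.
\<close>
definition covering_dim :: "'x topology \<Rightarrow> enat" where
  "covering_dim T = (INF n\<in>{n. covering_dim_le T n}. enat n)"

subsection \<open>Semi-simple actions\<close>

definition translation_length :: "'x set \<Rightarrow> ('x \<Rightarrow> 'x \<Rightarrow> real) \<Rightarrow> ('x \<Rightarrow> 'x) \<Rightarrow> real" where
  "translation_length M d \<gamma> = (INF x\<in>M. d x (\<gamma> x))"

definition semisimple :: "'x set \<Rightarrow> ('x \<Rightarrow> 'x \<Rightarrow> real) \<Rightarrow> ('x \<Rightarrow> 'x) \<Rightarrow> bool" where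
  "semisimple M d \<gamma> \<longleftrightarrow> (\<exists>x\<in>M. d x (\<gamma> x) = translation_length M d \<gamma>)"

definition isometric_action ::
  "('g, 'b) monoid_scheme \<Rightarrow> 'x set \<Rightarrow> ('x \<Rightarrow> 'x \<Rightarrow> real) \<Rightarrow> ('g \<Rightarrow> 'x \<Rightarrow> 'x) \<Rightarrow> bool" where
  "isometric_action G M d \<psi> \<longleftrightarrow>
     group_action G M \<psi> \<and>
     (\<forall>g\<in>carrier G. \<forall>x\<in>M. \<forall>y\<in>M. d (\<psi> g x) (\<psi> g y) = d x y)"

definition semisimple_action ::
  "('g, 'b) monoid_scheme \<Rightarrow> 'x set \<Rightarrow> ('x \<Rightarrow> 'x \<Rightarrow> real) \<Rightarrow> ('g \<Rightarrow> 'x \<Rightarrow> 'x) \<Rightarrow> bool" where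
  "semisimple_action G M d \<psi> \<longleftrightarrow>
     isometric_action G M d \<psi> \<and> (\<forall>g\<in>carrier G. semisimple M d (\<psi> g))"

end

theory Submission
  imports Defs "HOL-Real_Asymp.Real_Asymp"
begin

text \<open>
  Put \<open>t 0 = s\<close> and \<open>t i = g i s (g i)\<^sup>-\<^sup>1\<close>. Since disjoint supports force commutation, \<open>H i\<close> commutes
  with its conjugate by \<open>g i\<close>, so the \<open>k + 1\<close> elements \<open>t i\<close> commute pairwise. If \<open>s\<close> had no fixed
  point, then all \<open>t i\<close> would be hyperbolic. An isometry that commutes with \<open>t i\<close> changes the
  Busemann function of an axis of \<open>t i\<close> by an additive constant, which gives a real character on
  every group centralising \<open>t i\<close>. As the \<open>H i\<close> have no nontrivial characters, this Busemann
  function is invariant under the other \<open>t j\<close>, while \<open>t i\<close> shifts it by its translation length.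
  Interpolating geodesically between the orbit points of high powers of the \<open>t i\<close> yields a
  continuous image of a \<open>(k + 1)\<close>-cube whose opposite faces are separated by the Busemann functions,
  and Lebesgue's covering theorem shows that the covering dimension exceeds \<open>k\<close>.
\<close>

subsection \<open>Covering dimension and essential maps from cubes\<close>

text \<open>A finite value rules out the empty index set, whose infimum is infinite, and a nonempty
  set of extended naturals attains its infimum.\<close>

lemma covering_dim_eq_enatD:
  assumes "covering_dim T = enat n"
  shows "covering_dim_le T n"
proof -
  let ?S = "enat ` {n. covering_dim_le T n}"
  have ne: "?S \<noteq> {}"
    using assms unfolding covering_dim_def by (metis Inf_enat_def enat.distinct(1))
  have "Inf ?S \<in> ?S"
    using ne by (auto simp: Inf_enat_def simp del: image_is_empty intro: LeastI)
  then show ?thesis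
    using assms by (auto simp: covering_dim_def)
qed

text \<open>Kuhn's parity count gives an odd, hence nonzero, number of fully labelled simplices.
  Besides one of these, its base vertex \<open>b\<close> is extracted: all vertices differ from it
  by at most one grid step, which later allows a distance estimate.\<close>

lemma kuhn_rainbow_simplex:
  fixes n p :: nat
  assumes "0 < p"
    and "\<And>x j. (\<And>i. x i \<le> p) \<Longrightarrow> j < n \<Longrightarrow> x j = 0 \<Longrightarrow> lab x j = (0::nat)"
    and "\<And>x j. (\<And>i. x i \<le> p) \<Longrightarrow> j < n \<Longrightarrow> x j = p \<Longrightarrow> lab x j = 1"
  obtains S b where "(\<lambda>x. reduced n (lab x)) ` S = {..n}" "b \<in> S"
    and "\<And>x i. x \<in> S \<Longrightarrow> x i \<le> p"
    and "\<And>x i. x \<in> S \<Longrightarrow> b i \<le> x i \<and> x i \<le> Suc (b i)"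
proof -
  have "odd (card {s. ksimplex p n s \<and> (reduced n \<circ> lab) ` s = {..n}})"
    using assms by (intro kuhn_combinatorial) auto
  then have "{s. ksimplex p n s \<and> (reduced n \<circ> lab) ` s = {..n}} \<noteq> {}"
    by (rule odd_card_imp_not_empty)
  then obtain S b u where "kuhn_simplex p n b u S" and rl: "(reduced n \<circ> lab) ` S = {..n}"
    by (auto elim: ksimplex.cases)
  interpret kuhn_simplex p n b u S by fact
  show ?thesis
  proof
    show "(\<lambda>x. reduced n (lab x)) ` S = {..n}"
      using rl by (simp add: o_def)
    show "b \<in> S"
      using s_eq by (auto simp: enum_def image_iff intro!: bexI[of _ 0])
    show "x i \<le> p" if "x \<in> S" for x i
      using s_space out_eq_p[OF that] that by (cases "i < n") (auto simp: Pi_iff subset_iff)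
    show "b i \<le> x i \<and> x i \<le> Suc (b i)" if "x \<in> S" for x i
      using base_le[OF that] le_Suc_base[OF that] by auto
  qed
qed

context Metric_space
begin

text \<open>The images of the points of a fine finite grid form a net. In a complete space this
  makes the closure of the image compact, without putting a topology on the cube, whose points are
  functions with only the first \<open>n\<close> values constrained.\<close>

lemma mtotally_bounded_Lipschitz_cube:
  fixes f :: "(nat \<Rightarrow> real) \<Rightarrow> 'a" and n :: nat
  defines "Q \<equiv> {q. \<forall>i<n. 0 \<le> q i \<and> q i \<le> 1}"
  assumes fM: "\<And>q. q \<in> Q \<Longrightarrow> f q \<in> M"
    and lip: "\<And>q r e. \<lbrakk>0 \<le> e; q \<in> Q; r \<in> Q; \<And>i. i < n \<Longrightarrow> \<bar>q i - r i\<bar> \<le> e\<rbrakk> \<Longrightarrow> d (f q) (f r) \<le> L * e"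
    and "0 < L"
  shows "mtotally_bounded (f ` Q)"
  unfolding mtotally_bounded_def
proof (intro allI impI)
  fix \<epsilon> :: real
  assume "0 < \<epsilon>"
  obtain p :: nat where p: "0 < p" "L / real p < \<epsilon>"
    using reals_Archimedean2[of "L / \<epsilon>"] \<open>0 < \<epsilon>\<close> \<open>0 < L\<close>
    by (metis divide_pos_pos divide_less_eq mult.commute of_nat_0_less_iff order_less_trans)
  define N where "N = PiE {..<n} (\<lambda>_. (\<lambda>j. real j / real p) ` {..p})"
  have fin: "finite N"
    unfolding N_def by (intro finite_PiE) auto
  have NQ: "N \<subseteq> Q"
  proof
    fix r assume "r \<in> N"
    then have "\<exists>j\<le>p. r i = real j / real p" if "i < n" for i
      using that by (auto simp: N_def PiE_iff)
    then show "r \<in> Q"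
      using p(1) by (fastforce simp: Q_def)
  qed
  have "f q \<in> (\<Union>x\<in>f ` N. mball x \<epsilon>)" if q: "q \<in> Q" for q
  proof -
    \<comment> \<open>Rounding each coordinate down to the grid moves it by at most
      \<open>1 / p\<close>.\<close>
    define r where "r = restrict (\<lambda>i. real (nat \<lfloor>q i * real p\<rfloor>) / real p) {..<n}"
    have b: "0 \<le> q i * real p" "q i * real p \<le> real p" if "i < n" for i
      using q that p(1) by (auto simp: Q_def mult_le_cancel_right1)
    have "r \<in> N"
      using b by (auto simp: N_def r_def nat_le_iff floor_le_iff intro!: imageI) (smt (verit) of_int_of_nat_eq)
    moreover have "\<bar>r i - q i\<bar> \<le> 1 / real p" if "i < n" for i
    proof -
      have "\<bar>of_int \<lfloor>q i * real p\<rfloor> - q i * real p\<bar> \<le> 1"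
        by linarith
      moreover have "r i - q i = (of_int \<lfloor>q i * real p\<rfloor> - q i * real p) / real p"
        using that b[OF that] p(1) by (simp add: r_def field_simps)
      ultimately show ?thesis
        using p(1) by (simp add: divide_right_mono)
    qed
    then have "d (f r) (f q) \<le> L * (1 / real p)"
      using \<open>r \<in> N\<close> NQ q by (intro lip) auto
    ultimately show ?thesis
      using p(2) NQ q fM by (force simp: in_mball)
  qed
  then show "\<exists>K. finite K \<and> K \<subseteq> f ` Q \<and> f ` Q \<subseteq> (\<Union>x\<in>K. mball x \<epsilon>)"
    using fin NQ by (intro exI[of _ "f ` N"]) auto
qed

text \<open>
  Lebesgue's covering argument: colour the vertices of a fine triangulation of the cube by members
  of a refining cover. A vertex label that depends on the colour alone is Sperner, so some
  simplex sees \<open>n + 1\<close> colours, and they all contain its base vertex.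
\<close>
lemma covering_dim_ge_if_essential_cube:
  fixes f :: "(nat \<Rightarrow> real) \<Rightarrow> 'a" and u :: "nat \<Rightarrow> 'a \<Rightarrow> real" and n :: nat
  defines "Q \<equiv> {q. \<forall>i<n. 0 \<le> q i \<and> q i \<le> 1}"
  assumes "mcomplete"
    and fM: "\<And>q. q \<in> Q \<Longrightarrow> f q \<in> M"
    and lip: "\<And>q r e. \<lbrakk>0 \<le> e; q \<in> Q; r \<in> Q; \<And>i. i < n \<Longrightarrow> \<bar>q i - r i\<bar> \<le> e\<rbrakk> \<Longrightarrow> d (f q) (f r) \<le> L * e"
    and cont: "\<And>i. i < n \<Longrightarrow> continuous_map mtopology euclideanreal (u i)"
    and sep: "\<And>i. i < n \<Longrightarrow> \<alpha> i < \<beta> i"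
    and face0: "\<And>q i. q \<in> Q \<Longrightarrow> i < n \<Longrightarrow> q i = 0 \<Longrightarrow> u i (f q) \<le> \<alpha> i"
    and face1: "\<And>q i. q \<in> Q \<Longrightarrow> i < n \<Longrightarrow> q i = 1 \<Longrightarrow> \<beta> i \<le> u i (f q)"
    and dim: "covering_dim_le mtopology m"
  shows "n \<le> m"
proof -
  \<comment> \<open>The given \<open>L\<close> may be zero or negative, so it is raised to a
    positive constant.\<close>
  define L' where "L' = max L 1"
  have L': "0 < L'"
    by (simp add: L'_def)
  have lip': "d (f q) (f r) \<le> L' * e"
    if "0 \<le> e" "q \<in> Q" "r \<in> Q" "\<And>i. i < n \<Longrightarrow> \<bar>q i - r i\<bar> \<le> e" for q r e
    using lip[OF that] mult_right_mono[of L L' e] that(1) by (auto simp: L'_def)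
  have tb: "mtotally_bounded (f ` Q)"
    unfolding Q_def using fM L' lip' unfolding Q_def by (intro mtotally_bounded_Lipschitz_cube) blast+
  \<comment> \<open>The set \<open>\<sigma>\<close> records, coordinate by coordinate, which end is
    avoided: \<open>W \<sigma>\<close> misses the upper end in the coordinates of
    \<open>\<sigma>\<close> and the lower end in the others. Since \<alpha> is below \<beta>, these
    sets cover the space.\<close>
  define W where "W \<sigma> = {x \<in> M. \<forall>i<n. if i \<in> \<sigma> then u i x < \<beta> i else \<alpha> i < u i x}" for \<sigma> :: "nat set"
  have Wopen: "openin mtopology (W \<sigma>)" for \<sigma>
  proof -
    have 1: "openin mtopology {x \<in> M. if i \<in> \<sigma> then u i x < \<beta> i else \<alpha> i < u i x}" if "i < n" for i
      using openin_continuous_map_preimage[OF cont[OF that], of "{..<\<beta> i}"]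
        openin_continuous_map_preimage[OF cont[OF that], of "{\<alpha> i<..}"]
      by (cases "i \<in> \<sigma>") auto
    have "W \<sigma> = M \<inter> \<Inter>((\<lambda>i. {x \<in> M. if i \<in> \<sigma> then u i x < \<beta> i else \<alpha> i < u i x}) ` {..<n})"
      by (auto simp: W_def)
    also have "openin mtopology \<dots>"
      using 1 by (intro openin_Int_Inter) auto
    finally show ?thesis .
  qed
  have "x \<in> W {i. u i x < \<beta> i}" if "x \<in> M" for x
    using that sep by (force simp: W_def)
  then have "open_cover mtopology (range W)"
    using Wopen by (auto simp: open_cover_def) (auto simp: W_def)
  then obtain \<V> where cov: "open_cover mtopology \<V>"
    and ref: "\<And>V. V \<in> \<V> \<Longrightarrow> \<exists>\<sigma>. V \<subseteq> W \<sigma>"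
    and ord: "\<And>x. x \<in> M \<Longrightarrow> finite {V \<in> \<V>. x \<in> V} \<and> card {V \<in> \<V>. x \<in> V} \<le> m + 1"
  proof -
    obtain \<V> where \<V>: "open_cover mtopology \<V>" "\<forall>V\<in>\<V>. \<exists>U\<in>range W. V \<subseteq> U"
      "\<forall>x\<in>M. finite {V \<in> \<V>. x \<in> V} \<and> card {V \<in> \<V>. x \<in> V} \<le> m + 1"
      using dim \<open>open_cover mtopology (range W)\<close> unfolding covering_dim_le_def topspace_mtopology
      by blast
    show thesis
      using that[OF \<V>(1)] \<V>(2,3) by simp
  qed
  have cpt: "f ` Q \<subseteq> M" "compactin mtopology (mtopology closure_of (f ` Q))"
    using tb mtotally_bounded_eq_compact_closure_of[OF \<open>mcomplete\<close>] by auto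
  have "\<exists>\<epsilon>>0. \<forall>x\<in>mtopology closure_of (f ` Q). \<exists>V\<in>\<V>. mball x \<epsilon> \<subseteq> V"
    using cov closure_of_subset_topspace[of mtopology "f ` Q"]
    by (intro lebesgue_number cpt) (auto simp: open_cover_def)
  then obtain \<epsilon> where \<epsilon>: "0 < \<epsilon>" and leb: "\<And>x. x \<in> f ` Q \<Longrightarrow> \<exists>V\<in>\<V>. mball x \<epsilon> \<subseteq> V"
    using closure_of_subset[of "f ` Q" mtopology] cpt(1)
    by (metis subsetD topspace_mtopology)
  obtain p :: nat where p: "0 < p" "L' / real p < \<epsilon>"
    using reals_Archimedean2[of "L' / \<epsilon>"] \<open>0 < \<epsilon>\<close> \<open>0 < L'\<close>
    by (metis divide_pos_pos divide_less_eq mult.commute of_nat_0_less_iff order_less_trans)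
  define F where "F x = f (\<lambda>i. real (x i) / real p)" for x :: "nat \<Rightarrow> nat"
  define V where "V x = (SOME V. V \<in> \<V> \<and> mball (F x) \<epsilon> \<subseteq> V)" for x
  \<comment> \<open>A colour lies in some \<open>W \<sigma>\<close>, so it cannot meet both ends of
    a coordinate. Hence this label is 0 at grid points of the lower face and 1 at those of the upper
    face, as Kuhn's boundary conditions demand.\<close>
  define bit where "bit V i = (if \<exists>x\<in>V. u i x \<le> \<alpha> i then 0 else 1 :: nat)" for V i
  have inQ: "(\<lambda>i. real (x i) / real p) \<in> Q" if "\<And>i. x i \<le> p" for x
    using that p(1) by (auto simp: Q_def)
  have V: "V x \<in> \<V>" "mball (F x) \<epsilon> \<subseteq> V x" "F x \<in> V x" "F x \<in> M" if "\<And>i. x i \<le> p" for x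
  proof -
    have inQ: "(\<lambda>i. real (x i) / real p) \<in> Q"
      by (rule inQ) (rule that)
    have "V x \<in> \<V> \<and> mball (F x) \<epsilon> \<subseteq> V x"
      unfolding V_def by (rule someI_ex) (use leb inQ in \<open>auto simp: F_def\<close>)
    moreover show "F x \<in> M"
      using fM inQ by (simp add: F_def)
    ultimately show "V x \<in> \<V>" "mball (F x) \<epsilon> \<subseteq> V x" "F x \<in> V x"
      using \<epsilon> by auto
  qed
  obtain S b where rainbow: "(\<lambda>x. reduced n (bit (V x))) ` S = {..n}" and "b \<in> S"
    and Sp: "\<And>x i. x \<in> S \<Longrightarrow> x i \<le> p"
    and Sb: "\<And>x i. x \<in> S \<Longrightarrow> b i \<le> x i \<and> x i \<le> Suc (b i)"
  proof (rule kuhn_rainbow_simplex[OF p(1), of n "\<lambda>x. bit (V x)"])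
    fix x :: "nat \<Rightarrow> nat" and j
    assume xp: "\<And>i. x i \<le> p" and "j < n"
    have inQ: "(\<lambda>i. real (x i) / real p) \<in> Q"
      by (rule inQ) (rule xp)
    have V: "V x \<in> \<V>" "F x \<in> V x"
      using V[of x] xp by auto
    { assume "x j = 0"
      then have "u j (F x) \<le> \<alpha> j"
        using face0[OF inQ] \<open>j < n\<close> by (simp add: F_def)
      then show "bit (V x) j = 0"
        using V(2) by (auto simp: bit_def) }
    { assume "x j = p"
      then have "\<beta> j \<le> u j (F x)"
        unfolding F_def using \<open>j < n\<close> p(1) by (intro face1 inQ) auto
      moreover obtain \<sigma> where "V x \<subseteq> W \<sigma>"
        using ref V(1) by blast
      moreover from this have "j \<notin> \<sigma>"
        using calculation V(2) \<open>j < n\<close> by (force simp: W_def)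
      ultimately have "\<alpha> j < u j y" if "y \<in> V x" for y
        using that \<open>j < n\<close> by (force simp: W_def)
      then show "bit (V x) j = 1"
        by (force simp: bit_def) }
  qed (use that in blast)
  have "F b \<in> V x" if "x \<in> S" for x
  proof -
    have "d (F x) (F b) \<le> L' * (1 / real p)"
      unfolding F_def
    proof (rule lip')
      show "\<bar>real (x i) / real p - real (b i) / real p\<bar> \<le> 1 / real p" for i
        using Sb[OF that, of i] p(1) by (auto simp: diff_divide_distrib[symmetric] intro!: divide_right_mono)
    qed (use inQ Sp that \<open>b \<in> S\<close> in auto)
    then show ?thesis
      using V[of x] V[of b] Sp[OF that] Sp[OF \<open>b \<in> S\<close>] p(2) by (auto simp: in_mball subset_iff)
  qed
  then have "V ` S \<subseteq> {V \<in> \<V>. F b \<in> V}"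
    using V(1) Sp by auto
  \<comment> \<open>The reduced label factors through the colour, so \<open>n + 1\<close> labels
    force at least \<open>n + 1\<close> distinct colours, all of which contain
    \<open>F b\<close>.\<close>
  moreover have "{..n} = (\<lambda>V. reduced n (bit V)) ` V ` S"
    using rainbow by (simp add: image_image)
  moreover have fin: "finite {V \<in> \<V>. F b \<in> V}" "card {V \<in> \<V>. F b \<in> V} \<le> m + 1"
    using ord V(4)[of b] Sp[OF \<open>b \<in> S\<close>] by auto
  ultimately have "card {..n} \<le> m + 1"
    by (metis (no_types, lifting) card_image_le card_mono finite_subset order_trans)
  then show ?thesis
    by simp
qed

end

subsection \<open>CAT(0) geometry\<close>

text \<open>Put \<open>p\<close> at the origin and \<open>q\<close> on the first axis. The law of
  cosines dictates the first coordinate \<open>x\<close> of the third vertex, and the triangle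
  inequalities give \<open>\<bar>x\<bar> \<le> c\<close>, so its height is a real square
  root.\<close>

lemma comparison_triangle_exists:
  fixes a b c :: real
  assumes "0 \<le> a" "0 \<le> b" "0 \<le> c" "a \<le> b + c" "b \<le> a + c" "c \<le> a + b"
  obtains p q r :: "real^2" where "dist p q = a" "dist q r = b" "dist r p = c"
proof (cases "a = 0")
  case True
  \<comment> \<open>A vanishing side forces \<open>b = c\<close>, so two vertices coincide.\<close>
  then show thesis
    using assms that[of 0 0 "vector [c, 0]"]
    by (simp add: dist_norm norm_vec_def L2_set_def UNIV_2)
next
  case False
  define x where "x = (a\<^sup>2 + c\<^sup>2 - b\<^sup>2) / (2 * a)"
  have ax: "2 * a * x = a\<^sup>2 + c\<^sup>2 - b\<^sup>2"
    using False by (simp add: x_def)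
  have "(a - c)\<^sup>2 \<le> b\<^sup>2" "b\<^sup>2 \<le> (a + c)\<^sup>2"
    using assms by (auto intro!: abs_le_square_iff[THEN iffD1] power_mono)
  then have "2 * a * x \<le> 2 * a * c" "2 * a * (- c) \<le> 2 * a * x"
    unfolding ax by (auto simp: power2_eq_square algebra_simps)
  then have "x \<le> c" "- c \<le> x"
    using False \<open>0 \<le> a\<close> by (simp_all only: mult_le_cancel_left)
  then have "\<bar>x\<bar> \<le> c"
    by simp
  then have xc: "x\<^sup>2 \<le> c\<^sup>2"
    using abs_le_square_iff[of x c] assms(3) by simp
  have "(a - x)\<^sup>2 + (c\<^sup>2 - x\<^sup>2) = b\<^sup>2"
    using ax by (simp add: power2_eq_square algebra_simps)
  then show thesis
    using assms xc that[of 0 "vector [a, 0]" "vector [x, sqrt (c\<^sup>2 - x\<^sup>2)]"]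
    by (simp add: dist_norm norm_vec_def L2_set_def UNIV_2)
qed

text \<open>In a CAT(0) space this identity survives as an inequality, on which all later convexity
  estimates rest.\<close>

lemma euclidean_Stewart:
  fixes p q r :: "'v::real_inner"
  shows "(dist r ((1 - l) *\<^sub>R p + l *\<^sub>R q))\<^sup>2 =
    (1 - l) * (dist r p)\<^sup>2 + l * (dist r q)\<^sup>2 - l * (1 - l) * (dist p q)\<^sup>2"
  unfolding dist_norm power2_norm_eq_inner
  by (simp add: inner_simps inner_commute algebra_simps)

locale CAT0 = Metric_space M d for M :: "'x set" and d +
  assumes CAT0_space: "CAT0_space M d"
begin

section \<open>Geodesic interpolation and convexity of the metric\<close>

definition geodesic_point :: "'x \<Rightarrow> 'x \<Rightarrow> real \<Rightarrow> 'x \<Rightarrow> bool" where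
  "geodesic_point x y l z \<longleftrightarrow> (\<exists>c. geodesic_path M d c x y \<and> z = c (l * d x y))"

text \<open>The choice of path does not involve \<open>l\<close>, so all values for fixed endpoints
  lie on one geodesic. The relation \<open>geodesic_point\<close> complements it: it passes to
  reversed paths and to images under isometries, where a chosen path need not be respected.\<close>

definition geo :: "'x \<Rightarrow> 'x \<Rightarrow> real \<Rightarrow> 'x" where
  "geo x y l = (SOME c. geodesic_path M d c x y) (l * d x y)"

lemma geodesic_path_exists:
  assumes "x \<in> M" "y \<in> M"
  shows "\<exists>c. geodesic_path M d c x y"
proof -
  have "geodesic_space M d"
    using CAT0_space unfolding CAT0_space_def by (elim conjE)
  then show ?thesis
    using assms unfolding geodesic_space_def geodesic_segment_def by metis
qed

lemma geodesic_path_reverse: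
  assumes "geodesic_path M d c x y"
  shows "geodesic_path M d (\<lambda>t. c (d x y - t)) y x"
  using assms unfolding geodesic_path_def by (auto simp: commute[of y x] image_subset_iff)

lemma fraction_in_interval:
  "\<lbrakk>0 \<le> l; l \<le> 1\<rbrakk> \<Longrightarrow> l * d x y \<in> {0..d x y}"
  using mult_right_mono[of l 1 "d x y"] by simp

lemma geodesic_point_geo:
  assumes "x \<in> M" "y \<in> M"
  shows "geodesic_point x y l (geo x y l)"
  unfolding geodesic_point_def geo_def using someI_ex[OF geodesic_path_exists[OF assms]] by blast

lemma dist_geo_geo:
  assumes "x \<in> M" "y \<in> M" "0 \<le> l" "l \<le> 1" "0 \<le> m" "m \<le> 1"
  shows "d (geo x y l) (geo x y m) = \<bar>l - m\<bar> * d x y"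
proof -
  let ?c = "SOME c. geodesic_path M d c x y"
  have "geodesic_path M d ?c x y"
    by (rule someI_ex[OF geodesic_path_exists[OF assms(1,2)]])
  then have "d (geo x y l) (geo x y m) = \<bar>l * d x y - m * d x y\<bar>"
    unfolding geo_def geodesic_path_def
    using fraction_in_interval[OF assms(3,4)] fraction_in_interval[OF assms(5,6)] by blast
  then show ?thesis
    by (simp add: left_diff_distrib[symmetric] abs_mult)
qed

lemma geodesic_pointD:
  assumes "geodesic_point x y l z" "0 \<le> l" "l \<le> 1"
  shows "x \<in> M" "y \<in> M" "z \<in> M" "d x z = l * d x y" "d y z = (1 - l) * d x y"
proof -
  obtain c where c: "geodesic_path M d c x y" "z = c (l * d x y)"
    using assms by (auto simp: geodesic_point_def)
  note l = fraction_in_interval[OF assms(2,3), of x y]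
  have ends: "c 0 = x" "c (d x y) = y" "c ` {0..d x y} \<subseteq> M"
    and c_iso: "\<And>s t. \<lbrakk>s \<in> {0..d x y}; t \<in> {0..d x y}\<rbrakk> \<Longrightarrow> d (c s) (c t) = \<bar>s - t\<bar>"
    using c by (auto simp: geodesic_path_def)
  show "x \<in> M" "y \<in> M" "z \<in> M"
    using ends(3)[THEN subsetD, OF imageI] ends(1,2) l c(2) nonneg[of x y]
    by (metis atLeastAtMost_iff order_refl)+
  show "d x z = l * d x y" "d y z = (1 - l) * d x y"
    using c_iso[of 0 "l * d x y"] c_iso[of "d x y" "l * d x y"] ends(1,2) c(2) l
    by (auto simp: algebra_simps)
qed

lemma geodesic_point_reverse:
  assumes "geodesic_point x y l z"
  shows "geodesic_point y x (1 - l) z"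
proof -
  obtain c where c: "geodesic_path M d c x y" "z = c (l * d x y)"
    using assms by (auto simp: geodesic_point_def)
  have "z = c (d x y - (1 - l) * d y x)"
    using c(2) by (simp add: commute[of y x] left_diff_distrib)
  then show ?thesis
    using geodesic_path_reverse[OF c(1)] unfolding geodesic_point_def by blast
qed

lemma geo_in_M: "\<lbrakk>x \<in> M; y \<in> M; 0 \<le> l; l \<le> 1\<rbrakk> \<Longrightarrow> geo x y l \<in> M"
  using geodesic_pointD(3) geodesic_point_geo by blast

text \<open>Compare \<open>r\<close> and \<open>z\<close> with their comparison points and apply
  Stewart's identity in the plane.\<close>

lemma CAT0_Stewart:
  assumes z: "geodesic_point p q l z" and l: "0 \<le> l" "l \<le> 1" and r: "r \<in> M"
  shows "(d r z)\<^sup>2 \<le> (1 - l) * (d r p)\<^sup>2 + l * (d r q)\<^sup>2 - l * (1 - l) * (d p q)\<^sup>2"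
proof -
  note zD = geodesic_pointD[OF z l]
  obtain c where c: "geodesic_path M d c p q" "z = c (l * d p q)"
    using z by (auto simp: geodesic_point_def)
  let ?S1 = "c ` {0..d p q}"
  have S1: "geodesic_segment M d p q ?S1"
    using c by (auto simp: geodesic_segment_def)
  obtain S2 S3 where S2: "geodesic_segment M d q r S2" and S3: "geodesic_segment M d r p S3"
    using geodesic_path_exists zD(1,2) r unfolding geodesic_segment_def by meson
  have "r \<in> S2"
  proof -
    obtain c2 where "c2 (d q r) = r" "S2 = c2 ` {0..d q r}"
      using S2 by (auto simp: geodesic_segment_def geodesic_path_def)
    then show ?thesis
      by (metis atLeastAtMost_iff image_eqI nonneg order_refl)
  qed
  have "d p q \<le> d q r + d r p" "d q r \<le> d p q + d r p" "d r p \<le> d p q + d q r"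
    using triangle[of p r q] triangle[of q p r] triangle[of r q p] zD(1,2) r by (auto simp: commute)
  then obtain p' q' r' :: "real^2" where tri: "dist p' q' = d p q" "dist q' r' = d q r" "dist r' p' = d r p"
    using comparison_triangle_exists[of "d p q" "d q r" "d r p"] by auto
  define z' where "z' = (1 - l) *\<^sub>R p' + l *\<^sub>R q'"
  have "z' - p' = l *\<^sub>R (q' - p')"
    by (simp add: z'_def algebra_simps)
  then have "dist p' z' = d p z"
    using tri(1) l zD(4) by (metis abs_of_nonneg dist_commute dist_norm norm_scaleR)
  moreover have "z' \<in> closed_segment p' q'"
    using l by (auto simp: z'_def closed_segment_def)
  moreover have "z \<in> ?S1"
    using c(2) fraction_in_interval[OF l] by blast
  ultimately have 1: "comparison_point d p q r ?S1 S2 S3 p' q' r' z z'"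
    by (auto simp: comparison_point_def)
  have 2: "comparison_point d p q r ?S1 S2 S3 p' q' r' r r'"
    using \<open>r \<in> S2\<close> tri by (auto simp: comparison_point_def)
  have "d r z \<le> dist r' z'"
    using CAT0_space zD(1,2) r S1 S2 S3 tri 1 2 unfolding CAT0_space_def by blast
  then have "(d r z)\<^sup>2 \<le> (dist r' z')\<^sup>2"
    by (simp add: power_mono)
  then show ?thesis
    unfolding z'_def euclidean_Stewart using tri by (simp add: dist_commute commute)
qed

text \<open>By the triangle inequality the last term in Stewart's inequality is at least
  \<open>l * (1 - l) * (d r p - d r q)\<^sup>2\<close>, which turns the right-hand side into a
  perfect square.\<close>

lemma dist_convex:
  assumes z: "geodesic_point p q l z" and l: "0 \<le> l" "l \<le> 1" and r: "r \<in> M"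
  shows "d r z \<le> (1 - l) * d r p + l * d r q"
proof -
  note zD = geodesic_pointD[OF z l]
  have "\<bar>d r p - d r q\<bar> \<le> d p q"
    using triangle[of r p q] triangle[of r q p] zD(1,2) r by (auto simp: commute)
  then have "(d r p - d r q)\<^sup>2 \<le> (d p q)\<^sup>2"
    using abs_le_square_iff[of "d r p - d r q" "d p q"] by simp
  then have "l * (1 - l) * (d r p - d r q)\<^sup>2 \<le> l * (1 - l) * (d p q)\<^sup>2"
    using l by (intro mult_left_mono) auto
  then have "(d r z)\<^sup>2 \<le> ((1 - l) * d r p + l * d r q)\<^sup>2"
    using CAT0_Stewart[OF assms] by (simp add: power2_eq_square algebra_simps)
  then show ?thesis
    by (rule power2_le_imp_le) (use l in simp)
qed

text \<open>Stewart's inequality is used twice: with \<open>z\<close> against \<open>[p,q']\<close>,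
  then with \<open>q'\<close> against \<open>[p,q]\<close>. All terms except the one in
  \<open>d q q'\<close> cancel.\<close>

lemma geodesic_point_contraction:
  assumes z: "geodesic_point p q l z" and z': "geodesic_point p q' l z'" and l: "0 \<le> l" "l \<le> 1"
  shows "d z z' \<le> l * d q q'"
proof -
  note zD = geodesic_pointD[OF z l] and zD' = geodesic_pointD[OF z' l]
  have 1: "(d z z')\<^sup>2 \<le> (1 - l) * (d z p)\<^sup>2 + l * (d z q')\<^sup>2 - l * (1 - l) * (d p q')\<^sup>2"
    using CAT0_Stewart[OF z' l zD(3)] .
  have "(d z q')\<^sup>2 \<le> (1 - l) * (d q' p)\<^sup>2 + l * (d q' q)\<^sup>2 - l * (1 - l) * (d p q)\<^sup>2"
    using CAT0_Stewart[OF z l zD'(2)] by (simp add: commute)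
  then have 2: "l * (d z q')\<^sup>2 \<le> l * ((1 - l) * (d q' p)\<^sup>2 + l * (d q' q)\<^sup>2 - l * (1 - l) * (d p q)\<^sup>2)"
    using l(1) by (rule mult_left_mono)
  have 3: "d z p = l * d p q"
    using zD(4) by (simp add: commute)
  have "(d z z')\<^sup>2 \<le> (l * d q q')\<^sup>2"
    using 1 2 unfolding 3 commute[of q' p] commute[of q' q] by (simp add: power2_eq_square algebra_simps)
  then show ?thesis
    by (rule power2_le_imp_le) (use l in simp)
qed

text \<open>Insert the diagonal \<open>[p,q']\<close> and contract once towards each of its
  ends.\<close>

lemma geodesic_point_convex:
  assumes z: "geodesic_point p q l z" and z': "geodesic_point p' q' l z'" and l: "0 \<le> l" "l \<le> 1"
  shows "d z z' \<le> (1 - l) * d p p' + l * d q q'"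
proof -
  note zD = geodesic_pointD[OF z l] and zD' = geodesic_pointD[OF z' l]
  define w where "w = geo p q' l"
  have w: "geodesic_point p q' l w"
    unfolding w_def using zD(1) zD'(2) by (rule geodesic_point_geo)
  have "d z w \<le> l * d q q'"
    using geodesic_point_contraction[OF z w l] .
  moreover have "d w z' \<le> (1 - l) * d p p'"
    using geodesic_point_contraction[OF geodesic_point_reverse[OF w] geodesic_point_reverse[OF z']] l
    by simp
  moreover have "w \<in> M"
    using geodesic_pointD(3)[OF w l] .
  ultimately show ?thesis
    using triangle[of z w z'] zD(3) zD'(3) by simp
qed

text \<open>
  The horofunction estimate: seen from \<open>y\<close> and \<open>w\<close>, a far away point \<open>z\<close> can be replaced by
  the point \<open>p\<close> on \<open>[y,z]\<close> at distance \<open>R\<close> from \<open>y\<close>, with an error that depends only on \<open>R\<close>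
  and \<open>d y w\<close>.
\<close>
lemma horofunction_estimate:
  assumes p: "geodesic_point y z l p" and l: "0 \<le> l" "l \<le> 1" and w: "w \<in> M"
    and R: "d y w < l * d y z"
  shows "\<bar>(d y z - d w z) - (l * d y z - d w p)\<bar> \<le> (d y w)\<^sup>2 / (2 * (l * d y z - d y w))"
proof -
  note pD = geodesic_pointD[OF p l]
  define D a u R where "D = d y z" "a = d y w" "u = d w z" "R = l * d y z"
  note defs = this
  have "u \<le> d w p + (D - R)"
    using triangle[of w p z] w pD by (simp add: defs commute algebra_simps)
  \<comment> \<open>Stewart's inequality bounds \<open>(d w p)\<^sup>2\<close> by
    \<open>(R + (u - D))\<^sup>2 + a\<^sup>2\<close>. The extra \<open>a\<^sup>2\<close> is absorbed
    by the increment \<open>a\<^sup>2 / (2 * (R - a))\<close>, because \<open>R + (u - D)\<close> is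
    at least \<open>R - a\<close>.\<close>
  moreover have "d w p \<le> R + (u - D) + a\<^sup>2 / (2 * (R - a))"
  proof -
    have ua: "\<bar>u - D\<bar> \<le> a"
      using triangle[of w y z] triangle[of y w z] w pD(1,2) by (simp add: defs commute)
    then have pos: "0 < R - a" "R - a \<le> R + (u - D)"
      using R by (auto simp: defs)
    have "(d w p)\<^sup>2 \<le> (1 - l) * a\<^sup>2 + l * u\<^sup>2 - l * (1 - l) * D\<^sup>2"
      using CAT0_Stewart[OF p l w] by (simp add: defs commute)
    also have "\<dots> = (R + (u - D))\<^sup>2 + a\<^sup>2 - l * a\<^sup>2 - (1 - l) * (u - D)\<^sup>2"
      unfolding defs(4) defs(1)[symmetric] by (simp add: power2_eq_square algebra_simps)
    also have "\<dots> \<le> (R + (u - D))\<^sup>2 + a\<^sup>2"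
    proof -
      have "0 \<le> l * a\<^sup>2" "0 \<le> (1 - l) * (u - D)\<^sup>2"
        using l by simp_all
      then show ?thesis by linarith
    qed
    also have "\<dots> \<le> (R + (u - D) + a\<^sup>2 / (2 * (R - a)))\<^sup>2"
    proof -
      have "a\<^sup>2 = 2 * (R - a) * (a\<^sup>2 / (2 * (R - a)))"
        using pos(1) by simp
      also have "\<dots> \<le> 2 * (R + (u - D)) * (a\<^sup>2 / (2 * (R - a)))"
        using pos by (intro mult_right_mono) auto
      also have "\<dots> + (R + (u - D))\<^sup>2 \<le> (R + (u - D) + a\<^sup>2 / (2 * (R - a)))\<^sup>2"
        by (simp add: power2_sum)
      finally show ?thesis by simp
    qed
    finally show ?thesis
      by (rule power2_le_imp_le) (use pos in simp)
  qed
  ultimately show ?thesis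
    unfolding defs[symmetric] using R by (auto simp: defs abs_le_iff)
qed

text \<open>Replace both far points by points at distance about \<open>sqrt D\<close> from
  \<open>y\<close>, where \<open>D\<close> is the distance to \<open>z n\<close>. This radius tends
  to infinity, so the truncation errors vanish; it is small compared with \<open>D\<close>, so
  contraction makes the two truncated points merge.\<close>

lemma asymptotic_horofunctions:
  fixes z z' :: "nat \<Rightarrow> 'x"
  assumes M: "\<And>n. z n \<in> M" "\<And>n. z' n \<in> M" "y \<in> M" "w \<in> M"
    and K: "\<And>n. d (z n) (z' n) \<le> K"
    and inf: "filterlim (\<lambda>n. d y (z n)) at_top sequentially"
  shows "(\<lambda>n. (d y (z n) - d w (z n)) - (d y (z' n) - d w (z' n))) \<longlonglongrightarrow> 0"
proof -
  define a where "a = d y w"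
  \<comment> \<open>One \<open>K / sqrt D\<close> pays for the distance between the truncated points
    and one for the difference of their radii. The last term is the sum of two truncation errors,
    for radii of at least \<open>sqrt D - K / sqrt D\<close>.\<close>
  define e where "e D = 2 * K / sqrt D + a\<^sup>2 / (sqrt D - K / sqrt D - a)" for D
  have "(e \<longlongrightarrow> 0) at_top"
    unfolding e_def by real_asymp
  then have lim: "(\<lambda>n. e (d y (z n))) \<longlonglongrightarrow> 0"
    using inf by (rule filterlim_compose)
  have "0 \<le> K"
    using K[of 0] nonneg order_trans by blast
  have "\<forall>\<^sub>F D in at_top. 1 \<le> D \<and> a < sqrt D - K / sqrt D"
    by (intro eventually_conj eventually_ge_at_top) real_asymp
  then have "\<forall>\<^sub>F n in sequentially. 1 \<le> d y (z n) \<and> a < sqrt (d y (z n)) - K / sqrt (d y (z n))"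
    using inf by (rule eventually_compose_filterlim)
  then have "\<forall>\<^sub>F n in sequentially.
    norm ((d y (z n) - d w (z n)) - (d y (z' n) - d w (z' n))) \<le> e (d y (z n))"
  proof eventually_elim
    case (elim n)
    define D where "D = d y (z n)"
    \<comment> \<open>This fraction makes the truncation radius \<open>l * D\<close> equal to
      \<open>sqrt D\<close>.\<close>
    define l where "l = 1 / sqrt D"
    have D: "1 \<le> sqrt D" "D = sqrt D * sqrt D" "a < sqrt D - K / sqrt D"
      using elim by (auto simp: D_def)
    have l: "0 \<le> l" "l \<le> 1" "l * D = sqrt D" "l * K = K / sqrt D"
      using D(1) D(2) by (auto simp: l_def real_div_sqrt)
    define p where "p = geo y (z n) l"
    define p' where "p' = geo y (z' n) l"
    have p: "geodesic_point y (z n) l p" "geodesic_point y (z' n) l p'"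
      using M by (auto simp: p_def p'_def geodesic_point_geo)
    have D': "\<bar>D - d y (z' n)\<bar> \<le> K"
      using triangle[of y "z n" "z' n"] triangle[of y "z' n" "z n"] M K[of n] by (simp add: D_def commute)
    then have "l * \<bar>D - d y (z' n)\<bar> \<le> l * K"
      using l(1) by (rule mult_left_mono)
    moreover have "l * \<bar>D - d y (z' n)\<bar> = \<bar>l * D - l * d y (z' n)\<bar>"
      using l(1) by (simp add: abs_mult right_diff_distrib[symmetric])
    ultimately have R': "\<bar>sqrt D - l * d y (z' n)\<bar> \<le> K / sqrt D"
      using l(3,4) by simp
    have "d p p' \<le> l * d (z n) (z' n)"
      using geodesic_point_contraction[OF p l(1,2)] .
    also have "\<dots> \<le> K / sqrt D"
      unfolding l(4)[symmetric] using K[of n] l(1) by (rule mult_left_mono)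
    finally have "\<bar>d w p - d w p'\<bar> \<le> K / sqrt D"
      using triangle[of w p p'] triangle[of w p' p] geodesic_pointD(3)[OF p(1) l(1,2)]
        geodesic_pointD(3)[OF p(2) l(1,2)] M by (simp add: commute)
    moreover have "\<bar>(D - d w (z n)) - (sqrt D - d w p)\<bar> \<le> a\<^sup>2 / (2 * (sqrt D - a))"
      using horofunction_estimate[OF p(1) l(1,2) M(4)] D(3) \<open>0 \<le> K\<close> D(1)
      unfolding a_def[symmetric] D_def[symmetric] l(3) by (smt (verit) divide_nonneg_nonneg)
    moreover have "a\<^sup>2 / (2 * (sqrt D - a)) \<le> a\<^sup>2 / (2 * (sqrt D - K / sqrt D - a))"
      using D(1,3) \<open>0 \<le> K\<close> by (intro frac_le) auto
    moreover have "\<bar>(d y (z' n) - d w (z' n)) - (l * d y (z' n) - d w p')\<bar> \<le> a\<^sup>2 / (2 * (l * d y (z' n) - a))"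
      using horofunction_estimate[OF p(2) l(1,2) M(4)] D(3) R'
      unfolding a_def[symmetric] by (smt (verit))
    moreover have "a\<^sup>2 / (2 * (l * d y (z' n) - a)) \<le> a\<^sup>2 / (2 * (sqrt D - K / sqrt D - a))"
      using D(1,3) R' by (intro frac_le) auto
    moreover have "e D = 2 * (K / sqrt D) + 2 * (a\<^sup>2 / (2 * (sqrt D - K / sqrt D - a)))"
    proof -
      have "a\<^sup>2 / t = 2 * (a\<^sup>2 / (2 * t))" for t :: real
        by simp
      then show ?thesis
        unfolding e_def by (metis times_divide_eq_right)
    qed
    ultimately show ?case
      unfolding D_def[symmetric] real_norm_def using R' by linarith
  qed
  then show ?thesis
    using lim by (rule Lim_null_comparison)
qed

subsection \<open>Busemann functions of axes\<close>

definition isometry :: "('x \<Rightarrow> 'x) \<Rightarrow> bool" where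
  "isometry T \<longleftrightarrow> T \<in> M \<rightarrow> M \<and> (\<forall>x\<in>M. \<forall>y\<in>M. d (T x) (T y) = d x y)"

lemma isometry_in_M: "\<lbrakk>isometry T; x \<in> M\<rbrakk> \<Longrightarrow> T x \<in> M"
  by (auto simp: isometry_def)

lemma isometry_dist: "\<lbrakk>isometry T; x \<in> M; y \<in> M\<rbrakk> \<Longrightarrow> d (T x) (T y) = d x y"
  by (simp add: isometry_def)

lemma isometry_funpow: "isometry T \<Longrightarrow> isometry (T ^^ n)"
  by (induction n) (auto simp: isometry_def Pi_iff)

lemma geodesic_point_isometry:
  assumes "isometry T" "geodesic_point x y l z" "0 \<le> l" "l \<le> 1"
  shows "geodesic_point (T x) (T y) l (T z)"
proof -
  obtain c where c: "geodesic_path M d c x y" "z = c (l * d x y)"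
    using assms by (auto simp: geodesic_point_def)
  have "d (T x) (T y) = d x y"
    using geodesic_pointD(1,2)[OF assms(2-4)] by (rule isometry_dist[OF assms(1)])
  moreover from this have "geodesic_path M d (T \<circ> c) (T x) (T y)"
    using c(1) assms(1) unfolding geodesic_path_def isometry_def by (auto simp: image_subset_iff)
  ultimately show ?thesis
    using c(2) unfolding geodesic_point_def by (metis comp_apply)
qed

section \<open>Minimal displacement and orbits\<close>

definition minimal_point :: "('x \<Rightarrow> 'x) \<Rightarrow> 'x \<Rightarrow> bool" where
  "minimal_point T x \<longleftrightarrow> x \<in> M \<and> (\<forall>y\<in>M. d x (T x) \<le> d y (T y))"

text \<open>
  If \<open>m\<close> is the midpoint of \<open>y\<close> and \<open>T y\<close>, then \<open>d m (T m)\<close> is at most half of \<open>d y (T (T y))\<close>.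
\<close>
lemma displacement_comp_self:
  assumes T: "isometry T" and x: "minimal_point T x" and y: "y \<in> M"
  shows "2 * d x (T x) \<le> d y (T (T y))"
proof -
  define m where "m = geo y (T y) (1/2)"
  have m: "geodesic_point y (T y) (1/2) m"
    unfolding m_def using y T by (auto intro: geodesic_point_geo isometry_in_M)
  have "d m (T m) \<le> 1/2 * d y (T (T y))"
    using geodesic_point_contraction[OF geodesic_point_reverse[OF m]]
      geodesic_point_isometry[OF T m] by simp
  moreover have "d x (T x) \<le> d m (T m)"
    using x geodesic_pointD(3)[OF m] by (simp add: minimal_point_def)
  ultimately show ?thesis by simp
qed

lemma dist_funpow_le:
  assumes T: "isometry T" and y: "y \<in> M"
  shows "d y ((T ^^ n) y) \<le> real n * d y (T y)"
proof (induction n)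
  case (Suc n)
  have "d (T y) (T ((T ^^ n) y)) = d y ((T ^^ n) y)"
    using T y by (intro isometry_dist isometry_in_M[OF isometry_funpow])
  then have "d y ((T ^^ Suc n) y) \<le> d y (T y) + d y ((T ^^ n) y)"
    using triangle[of y "T y" "T ((T ^^ n) y)"] T y
    by (simp add: isometry_in_M isometry_in_M[OF isometry_funpow])
  then show ?case
    using Suc by (simp add: algebra_simps)
qed (use y in simp)

text \<open>Doubling the exponent doubles the displacement, which settles powers of two. For other
  \<open>n\<close>, the orbit up to a larger power of two is as long as its endpoints are far apart,
  so no initial piece can be shortened.\<close>

lemma dist_funpow_minimal_point:
  assumes T: "isometry T" and x: "minimal_point T x"
  shows "d x ((T ^^ n) x) = real n * d x (T x)"
proof -
  let ?\<tau> = "d x (T x)"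
  have xM: "x \<in> M"
    using x by (simp add: minimal_point_def)
  \<comment> \<open>Minimality is carried along, since the next doubling step requires
    \<open>x\<close> to be minimal for the power itself.\<close>
  have pow2: "minimal_point (T ^^ (2 ^ j)) x \<and> d x ((T ^^ (2 ^ j)) x) = 2 ^ j * ?\<tau>" for j
  proof (induction j)
    case (Suc j)
    let ?S = "T ^^ (2 ^ j)"
    have S: "isometry ?S"
      using T by (rule isometry_funpow)
    have SS: "(T ^^ (2 ^ Suc j)) y = ?S (?S y)" for y
      by (simp add: mult_2 funpow_add)
    have ge: "2 ^ Suc j * ?\<tau> \<le> d y (?S (?S y))" if "y \<in> M" for y
      using displacement_comp_self[OF S _ that] Suc by fastforce
    have "d x (?S (?S x)) \<le> 2 ^ Suc j * ?\<tau>"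
      using dist_funpow_le[OF T xM, of "2 ^ Suc j"] unfolding SS by simp
    then have "d x (?S (?S x)) = 2 ^ Suc j * ?\<tau>"
      using ge[OF xM] by simp
    then show ?case
      using ge xM unfolding minimal_point_def SS by simp
  qed (use x in simp)
  have nM: "(T ^^ m) x \<in> M" for m
    using isometry_in_M[OF isometry_funpow[OF T] xM] .
  have "n \<le> 2 ^ n"
    by (simp add: less_imp_le)
  then have "(T ^^ (2 ^ n)) x = (T ^^ n) ((T ^^ (2 ^ n - n)) x)"
    by (metis comp_apply funpow_add le_add_diff_inverse)
  then have "d ((T ^^ n) x) ((T ^^ (2 ^ n)) x) = d x ((T ^^ (2 ^ n - n)) x)"
    using isometry_dist[OF isometry_funpow[OF T] xM nM] by simp
  also have "\<dots> \<le> real (2 ^ n - n) * ?\<tau>"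
    using dist_funpow_le[OF T xM] .
  also have "\<dots> = 2 ^ n * ?\<tau> - real n * ?\<tau>"
    using \<open>n \<le> 2 ^ n\<close> by (simp add: of_nat_diff left_diff_distrib)
  finally have "real n * ?\<tau> \<le> d x ((T ^^ n) x)"
    using triangle[OF xM nM nM, of "2 ^ n" n] pow2[of n] by linarith
  then show ?thesis
    using dist_funpow_le[OF T xM, of n] by simp
qed

text \<open>
  If \<open>x\<close> is a minimal point, then the points \<open>T\<^sup>n x\<close> lie on an axis of \<open>T\<close>, whose Busemann function
  this is. For other \<open>x\<close> the limit need not exist.
\<close>
definition busemann :: "('x \<Rightarrow> 'x) \<Rightarrow> 'x \<Rightarrow> 'x \<Rightarrow> real" where
  "busemann T x y = lim (\<lambda>n. d y ((T ^^ n) x) - real n * d x (T x))"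

context
  fixes T x
  assumes T: "isometry T" and x: "minimal_point T x"
begin

lemma minimal_point_orbit_in_M: "(T ^^ n) x \<in> M"
  using isometry_in_M[OF isometry_funpow[OF T]] x by (simp add: minimal_point_def)

text \<open>Consecutive orbit points are \<open>d x (T x)\<close> apart, so the sequence decreases;
  the orbit of a minimal point grows exactly linearly, so it is bounded below.\<close>

lemma busemann_LIMSEQ:
  assumes y: "y \<in> M"
  shows "(\<lambda>n. d y ((T ^^ n) x) - real n * d x (T x)) \<longlonglongrightarrow> busemann T x y"
proof -
  let ?f = "\<lambda>n. d y ((T ^^ n) x) - real n * d x (T x)"
  have xM: "x \<in> M"
    using x by (simp add: minimal_point_def)
  have "d ((T ^^ n) x) ((T ^^ Suc n) x) = d x (T x)" for n
    using isometry_dist[OF isometry_funpow[OF T] xM isometry_in_M[OF T xM], of n]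
    by (simp add: funpow_swap1)
  then have "?f (Suc n) \<le> ?f n" for n
    using triangle[OF y minimal_point_orbit_in_M minimal_point_orbit_in_M, of "Suc n" n]
    by (simp add: commute algebra_simps)
  then have dec: "decseq ?f"
    by (rule decseq_SucI)
  have below: "- d y x \<le> ?f n" for n
    using triangle[OF xM y minimal_point_orbit_in_M, of n] dist_funpow_minimal_point[OF T x, of n]
    by (simp add: commute)
  obtain L where "?f \<longlonglongrightarrow> L"
    using decseq_convergent[OF dec] below by blast
  then have "convergent ?f"
    by (rule convergentI)
  then show ?thesis
    unfolding busemann_def by (simp add: convergent_LIMSEQ_iff)
qed

lemma busemann_Lipschitz:
  assumes "y \<in> M" "z \<in> M"
  shows "busemann T x y \<le> busemann T x z + d y z"
proof (rule LIMSEQ_le)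
  show "(\<lambda>n. d y ((T ^^ n) x) - real n * d x (T x)) \<longlonglongrightarrow> busemann T x y"
    using assms by (intro busemann_LIMSEQ)
  show "(\<lambda>n. d z ((T ^^ n) x) - real n * d x (T x) + d y z) \<longlonglongrightarrow> busemann T x z + d y z"
    using assms by (intro tendsto_intros busemann_LIMSEQ)
  show "\<exists>N. \<forall>n\<ge>N. d y ((T ^^ n) x) - real n * d x (T x) \<le> d z ((T ^^ n) x) - real n * d x (T x) + d y z"
    using triangle[OF assms minimal_point_orbit_in_M] by (simp add: add.commute)
qed

lemma continuous_map_busemann: "continuous_map mtopology euclideanreal (busemann T x)"
proof -
  have "\<bar>busemann T x y - busemann T x z\<bar> \<le> d y z" if "y \<in> M" "z \<in> M" for y z
    using busemann_Lipschitz[OF that] busemann_Lipschitz[OF that(2,1)] by (simp add: commute)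
  then have "Lipschitz_continuous_map (metric (M, d)) euclidean_metric (busemann T x)"
    unfolding Lipschitz_continuous_map_pos
    by (intro conjI exI[of _ 1]) (auto simp: mspace_metric mdist_metric dist_real_def)
  then show ?thesis
    using Lipschitz_imp_uniformly_continuous_map uniformly_continuous_imp_continuous_map
    by (metis mtopology_of mtopology_of_euclidean)
qed

lemma busemann_convex:
  assumes z: "geodesic_point p q l z" and l: "0 \<le> l" "l \<le> 1"
  shows "busemann T x z \<le> (1 - l) * busemann T x p + l * busemann T x q"
proof (rule LIMSEQ_le)
  note zD = geodesic_pointD[OF z l]
  let ?f = "\<lambda>y n. d y ((T ^^ n) x) - real n * d x (T x)"
  show "?f z \<longlonglongrightarrow> busemann T x z"
    using zD by (intro busemann_LIMSEQ)
  show "(\<lambda>n. (1 - l) * ?f p n + l * ?f q n) \<longlonglongrightarrow> (1 - l) * busemann T x p + l * busemann T x q"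
    using zD by (intro tendsto_intros busemann_LIMSEQ)
  have "?f z n \<le> (1 - l) * ?f p n + l * ?f q n" for n
    using dist_convex[OF z l minimal_point_orbit_in_M, of n]
    by (simp add: commute[of "(T ^^ n) x"] algebra_simps)
  then show "\<exists>N. \<forall>n\<ge>N. ?f z n \<le> (1 - l) * ?f p n + l * ?f q n"
    by blast
qed

lemma busemann_translation:
  assumes y: "y \<in> M"
  shows "busemann T x (T y) = busemann T x y - d x (T x)"
proof -
  have "d (T y) ((T ^^ Suc n) x) = d y ((T ^^ n) x)" for n
    using isometry_dist[OF T y minimal_point_orbit_in_M] by simp
  then have "(\<lambda>n. d (T y) ((T ^^ Suc n) x) - real (Suc n) * d x (T x)) =
      (\<lambda>n. (d y ((T ^^ n) x) - real n * d x (T x)) - d x (T x))"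
    by (simp add: algebra_simps)
  also have "\<dots> \<longlonglongrightarrow> busemann T x y - d x (T x)"
    using y by (intro tendsto_intros busemann_LIMSEQ)
  finally show ?thesis
    using LIMSEQ_unique LIMSEQ_Suc[OF busemann_LIMSEQ[OF isometry_in_M[OF T y]]] by blast
qed

text \<open>The map \<open>h'\<close> acts as the inverse of \<open>h\<close>. It commutes with
  \<open>T\<close>, so it moves every orbit point of \<open>x\<close> by the same distance, and the
  two orbits define the same horofunction up to a constant.\<close>

lemma busemann_commuting_isometry:
  assumes \<tau>: "0 < d x (T x)"
    and h': "\<And>u. u \<in> M \<Longrightarrow> h' u \<in> M" "\<And>u. u \<in> M \<Longrightarrow> h' (T u) = T (h' u)"
    and h: "\<And>u. u \<in> M \<Longrightarrow> h u \<in> M" "\<And>u v. u \<in> M \<Longrightarrow> v \<in> M \<Longrightarrow> d (h u) v = d u (h' v)"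
    and yw: "y \<in> M" "w \<in> M"
  shows "busemann T x (h y) - busemann T x y = busemann T x (h w) - busemann T x w"
proof -
  note orb = minimal_point_orbit_in_M
  have xM: "x \<in> M"
    using x by (simp add: minimal_point_def)
  have comm: "h' ((T ^^ n) x) = (T ^^ n) (h' x)" for n
    by (induction n) (simp_all add: h' orb)
  \<comment> \<open>Positive displacement makes the orbit escape to infinity, as the comparison of
    horofunctions requires.\<close>
  have "filterlim (\<lambda>n. real n * d x (T x) - d y x) at_top sequentially"
    using \<tau> by real_asymp
  moreover have "real n * d x (T x) - d y x \<le> d y ((T ^^ n) x)" for n
    using triangle[OF xM yw(1) orb, of n] dist_funpow_minimal_point[OF T x, of n]
    by (simp add: commute)
  ultimately have inf: "filterlim (\<lambda>n. d y ((T ^^ n) x)) at_top sequentially"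
    by (auto intro: filterlim_at_top_mono)
  have K: "d ((T ^^ n) x) (h' ((T ^^ n) x)) \<le> d x (h' x)" for n
    unfolding comm using isometry_dist[OF isometry_funpow[OF T] xM h'(1)[OF xM]] by simp
  have lim0: "(\<lambda>n. (d y ((T ^^ n) x) - d w ((T ^^ n) x))
      - (d y (h' ((T ^^ n) x)) - d w (h' ((T ^^ n) x)))) \<longlonglongrightarrow> 0"
    using orb h'(1)[OF orb] yw K inf by (rule asymptotic_horofunctions)
  let ?f = "\<lambda>y n. d y ((T ^^ n) x) - real n * d x (T x)"
  have lim: "(\<lambda>n. (?f y n - ?f w n) - (?f (h y) n - ?f (h w) n)) \<longlonglongrightarrow>
      (busemann T x y - busemann T x w) - (busemann T x (h y) - busemann T x (h w))"
    using yw h(1) by (intro tendsto_diff busemann_LIMSEQ)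
  have eq: "(?f y n - ?f w n) - (?f (h y) n - ?f (h w) n) = (d y ((T ^^ n) x) - d w ((T ^^ n) x))
      - (d y (h' ((T ^^ n) x)) - d w (h' ((T ^^ n) x)))" for n
    using h(2)[OF yw(1) orb] h(2)[OF yw(2) orb] by simp
  have "(busemann T x y - busemann T x w) - (busemann T x (h y) - busemann T x (h w)) = 0"
    using LIMSEQ_unique[OF lim[unfolded eq] lim0] .
  then show ?thesis by simp
qed

end

text \<open>The forward and the backward orbit points are \<open>2 * n\<close> displacements apart,
  so the triangle inequality through \<open>y\<close> bounds the sum of the two distances from
  below.\<close>

lemma busemann_inverse_nonneg:
  assumes T: "isometry T" and x: "minimal_point T x"
    and T': "isometry T'" "\<And>u. u \<in> M \<Longrightarrow> T (T' u) = u" and x': "minimal_point T' x"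
    and y: "y \<in> M"
  shows "0 \<le> busemann T x y + busemann T' x y"
proof -
  have xM: "x \<in> M"
    using x by (simp add: minimal_point_def)
  note orb = minimal_point_orbit_in_M[OF T x]
  have T'M: "(T' ^^ n) x \<in> M" for n
    using isometry_in_M[OF isometry_funpow[OF T'(1)] xM] .
  have cancel: "(T ^^ n) ((T' ^^ n) u) = u" if "u \<in> M" for n u
    using that
  proof (induction n arbitrary: u)
    case (Suc n)
    have "(T ^^ Suc n) ((T' ^^ Suc n) u) = T ((T ^^ n) ((T' ^^ n) (T' u)))"
      by (simp add: funpow_swap1)
    then show ?case
      using Suc T' by (simp add: isometry_in_M)
  qed simp
  have \<tau>: "d x (T' x) = d x (T x)"
    using isometry_dist[OF T xM isometry_in_M[OF T'(1) xM]] T'(2)[OF xM] by (simp add: commute)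
  have "2 * real n * d x (T x) \<le> d y ((T ^^ n) x) + d y ((T' ^^ n) x)" for n
  proof -
    have "d ((T ^^ n) x) ((T' ^^ n) x) = d ((T ^^ n) ((T ^^ n) x)) ((T ^^ n) ((T' ^^ n) x))"
      using isometry_dist[OF isometry_funpow[OF T] orb T'M] by simp
    also have "\<dots> = d x ((T ^^ (n + n)) x)"
      unfolding cancel[OF xM] funpow_add by (simp add: commute)
    also have "\<dots> = 2 * real n * d x (T x)"
      using dist_funpow_minimal_point[OF T x, of "n + n"] by simp
    finally show ?thesis
      using triangle[OF orb y T'M, of n n] by (simp add: commute)
  qed
  then have "0 \<le> (d y ((T ^^ n) x) - real n * d x (T x)) + (d y ((T' ^^ n) x) - real n * d x (T' x))" for n
    unfolding \<tau> by (simp add: algebra_simps)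
  moreover have "(\<lambda>n. (d y ((T ^^ n) x) - real n * d x (T x)) + (d y ((T' ^^ n) x) - real n * d x (T' x)))
      \<longlonglongrightarrow> busemann T x y + busemann T' x y"
    using busemann_LIMSEQ[OF T x y] busemann_LIMSEQ[OF T'(1) x' y] by (rule tendsto_add)
  ultimately show ?thesis
    by (intro LIMSEQ_le_const) auto
qed

subsection \<open>Geodesic cubes\<close>

text \<open>A curved parallelepiped: coordinate \<open>n\<close> runs along a geodesic from a point
  of the previous cube to its image under \<open>T n\<close>. A 0-1 vector \<open>q\<close> is sent
  to the image of \<open>x\<close> under those \<open>T j\<close> with \<open>q j = 1\<close>,
  applied in increasing order of \<open>j\<close>.\<close>

primrec geo_cube :: "(nat \<Rightarrow> 'x \<Rightarrow> 'x) \<Rightarrow> 'x \<Rightarrow> nat \<Rightarrow> (nat \<Rightarrow> real) \<Rightarrow> 'x" where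
  "geo_cube T x 0 q = x"
| "geo_cube T x (Suc n) q = geo (geo_cube T x n q) (T n (geo_cube T x n q)) (q n)"

lemma geo_cube_in_M:
  assumes "x \<in> M" "\<And>i. i < n \<Longrightarrow> isometry (T i)" "\<And>i. i < n \<Longrightarrow> 0 \<le> q i \<and> q i \<le> 1"
  shows "geo_cube T x n q \<in> M"
  using assms
proof (induction n)
  case (Suc n)
  then have "geo_cube T x n q \<in> M"
    by simp
  with Suc.prems show ?case
    by (simp add: geo_in_M isometry_in_M)
qed simp

text \<open>The speed in a new coordinate is the displacement of a point of the previous cube;
  boundedness of that cube keeps it under control.\<close>

lemma geo_cube_bounded:
  assumes x: "x \<in> M" and T: "\<And>i. i < n \<Longrightarrow> isometry (T i)"
  shows "\<exists>C. \<forall>q. (\<forall>i<n. 0 \<le> q i \<and> q i \<le> 1) \<longrightarrow> d x (geo_cube T x n q) \<le> C"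
  using T
proof (induction n)
  case (Suc n)
  then obtain C where C: "\<And>q. (\<forall>i<n. 0 \<le> q i \<and> q i \<le> 1) \<Longrightarrow> d x (geo_cube T x n q) \<le> C"
    by (meson less_SucI)
  have "d x (geo_cube T x (Suc n) q) \<le> 3 * C + d x (T n x)" if q: "\<forall>i<Suc n. 0 \<le> q i \<and> q i \<le> 1" for q
  proof -
    define y where "y = geo_cube T x n q"
    have M: "y \<in> M" "T n y \<in> M" "T n x \<in> M"
      unfolding y_def using Suc.prems q x by (simp_all add: geo_cube_in_M isometry_in_M)
    have xy: "d x y \<le> C"
      unfolding y_def using q by (intro C) auto
    have iso: "d (T n x) (T n y) = d x y"
      using Suc.prems x M(1) by (intro isometry_dist) auto
    have qn: "0 \<le> q n" "q n \<le> 1"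
      using q by auto
    have "d y (geo y (T n y) (q n)) \<le> d y (T n y)"
      using geodesic_pointD(4)[OF geodesic_point_geo[OF M(1,2)] qn] qn
      by (simp add: mult_left_le_one_le)
    moreover have "d y (T n y) \<le> d y x + d x (T n x) + d (T n x) (T n y)"
      using triangle[of y x "T n y"] triangle[of x "T n x" "T n y"] x M by simp
    moreover have "d x (geo y (T n y) (q n)) \<le> d x y + d y (geo y (T n y) (q n))"
      using triangle[OF x M(1) geo_in_M[OF M(1,2) qn]] .
    ultimately show ?thesis
      using xy iso commute[of y x] by (simp add: y_def[symmetric])
  qed
  then show ?case by blast
qed auto

text \<open>Split the change into a move between two geodesics at equal parameter, controlled by
  convexity of the metric, and a move along one geodesic.\<close>

lemma geo_cube_Lipschitz:
  assumes x: "x \<in> M" and T: "\<And>i. i < n \<Longrightarrow> isometry (T i)"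
  shows "\<exists>L. \<forall>q r e. 0 \<le> e \<longrightarrow> (\<forall>i<n. 0 \<le> q i \<and> q i \<le> 1) \<longrightarrow> (\<forall>i<n. 0 \<le> r i \<and> r i \<le> 1) \<longrightarrow>
    (\<forall>i<n. \<bar>q i - r i\<bar> \<le> e) \<longrightarrow> d (geo_cube T x n q) (geo_cube T x n r) \<le> L * e"
  using T
proof (induction n)
  case 0
  then show ?case
    using x by (intro exI[of _ 0]) simp
next
  case (Suc n)
  have "\<exists>L. \<forall>q r e. 0 \<le> e \<longrightarrow> (\<forall>i<n. 0 \<le> q i \<and> q i \<le> 1) \<longrightarrow> (\<forall>i<n. 0 \<le> r i \<and> r i \<le> 1) \<longrightarrow>
    (\<forall>i<n. \<bar>q i - r i\<bar> \<le> e) \<longrightarrow> d (geo_cube T x n q) (geo_cube T x n r) \<le> L * e"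
    using Suc.prems by (intro Suc.IH) simp
  then obtain L where L: "\<And>q r e. \<lbrakk>0 \<le> e; \<forall>i<n. 0 \<le> q i \<and> q i \<le> 1; \<forall>i<n. 0 \<le> r i \<and> r i \<le> 1;
      \<forall>i<n. \<bar>q i - r i\<bar> \<le> e\<rbrakk> \<Longrightarrow> d (geo_cube T x n q) (geo_cube T x n r) \<le> L * e"
    by blast
  obtain C where C: "\<And>q. (\<forall>i<n. 0 \<le> q i \<and> q i \<le> 1) \<Longrightarrow> d x (geo_cube T x n q) \<le> C"
    using geo_cube_bounded[OF x, of n T] Suc.prems by (meson less_SucI)
  \<comment> \<open>This bounds the displacement of \<open>T n\<close> on the previous cube, via a
    detour through \<open>x\<close> and \<open>T n x\<close>.\<close>
  define B where "B = 2 * C + d x (T n x)"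
  have "d (geo_cube T x (Suc n) q) (geo_cube T x (Suc n) r) \<le> (L + B) * e"
    if e: "0 \<le> e" and q: "\<forall>i<Suc n. 0 \<le> q i \<and> q i \<le> 1" and r: "\<forall>i<Suc n. 0 \<le> r i \<and> r i \<le> 1"
      and qr: "\<forall>i<Suc n. \<bar>q i - r i\<bar> \<le> e" for q r e
  proof -
    define y z where "y = geo_cube T x n q" "z = geo_cube T x n r"
    note yz = this
    have M: "y \<in> M" "T n y \<in> M" "z \<in> M" "T n z \<in> M" "T n x \<in> M"
      unfolding yz using Suc.prems q r x by (simp_all add: geo_cube_in_M isometry_in_M)
    have dyz: "d y z \<le> L * e"
      unfolding yz using e q r qr by (intro L) auto
    have iso: "d (T n y) (T n z) = d y z" "d (T n x) (T n z) = d x z"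
      using Suc.prems x M by (auto intro!: isometry_dist)
    have qn: "0 \<le> q n" "q n \<le> 1" and rn: "0 \<le> r n" "r n \<le> 1"
      using q r by auto
    have "d x z \<le> C"
      unfolding yz using r by (intro C) auto
    then have "d z (T n z) \<le> B"
      using triangle[of z x "T n z"] triangle[of x "T n x" "T n z"] x M iso(2) commute[of z x]
      by (simp add: B_def)
    then have "\<bar>q n - r n\<bar> * d z (T n z) \<le> e * B"
      using qr e by (intro mult_mono) auto
    then have "d (geo z (T n z) (q n)) (geo z (T n z) (r n)) \<le> e * B"
      using dist_geo_geo[OF M(3,4) qn rn] by simp
    moreover have "d (geo y (T n y) (q n)) (geo z (T n z) (q n)) \<le> d y z"
      using geodesic_point_convex[OF geodesic_point_geo[OF M(1,2)] geodesic_point_geo[OF M(3,4)] qn]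
      unfolding iso by (simp add: algebra_simps)
    ultimately show ?thesis
      using triangle[OF geo_in_M[OF M(1,2) qn] geo_in_M[OF M(3,4) qn] geo_in_M[OF M(3,4) rn]] dyz
      by (simp add: yz[symmetric] algebra_simps)
  qed
  then show ?case by blast
qed

text \<open>Convexity is applied to one coordinate at a time. A coordinate with
  \<open>q j = 0\<close> contributes no weight, so on a face \<open>q i = 0\<close> the bound makes
  no demand on \<open>T i\<close>.\<close>

lemma geo_cube_le:
  fixes b :: "'x \<Rightarrow> real"
  assumes x: "x \<in> M" and T: "\<And>j. j < n \<Longrightarrow> isometry (T j)"
    and q: "\<And>j. j < n \<Longrightarrow> 0 \<le> q j \<and> q j \<le> 1"
    and convex: "\<And>p q l z. \<lbrakk>geodesic_point p q l z; 0 \<le> l; l \<le> 1\<rbrakk> \<Longrightarrow> b z \<le> (1 - l) * b p + l * b q"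
    and shift: "\<And>j y. \<lbrakk>j < n; q j \<noteq> 0; y \<in> M\<rbrakk> \<Longrightarrow> b (T j y) = b y + c j"
  shows "b (geo_cube T x n q) \<le> b x + (\<Sum>j<n. q j * c j)"
  using T q shift
proof (induction n)
  case (Suc n)
  define y where "y = geo_cube T x n q"
  have y: "y \<in> M" "T n y \<in> M"
    unfolding y_def using Suc.prems x by (simp_all add: geo_cube_in_M isometry_in_M)
  have "b (geo y (T n y) (q n)) \<le> (1 - q n) * b y + q n * b (T n y)"
    using Suc.prems(2) by (intro convex[OF geodesic_point_geo[OF y]]) auto
  also have "\<dots> = b y + q n * c n"
    using Suc.prems(3)[of n y] y by (cases "q n = 0") (simp_all add: algebra_simps)
  also have "b y \<le> b x + (\<Sum>j<n. q j * c j)"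
    unfolding y_def using Suc by simp
  finally show ?case
    by (simp add: y_def)
qed simp

text \<open>
  The Busemann functions of \<open>T i\<close> and of its inverse are convex on the geodesic cube spanned by
  high powers of the \<open>T j\<close>, so they separate its opposite faces.
\<close>
lemma covering_dim_ge_if_independent_translations:
  fixes T T' :: "nat \<Rightarrow> 'x \<Rightarrow> 'x" and p :: "nat \<Rightarrow> 'x" and n m :: nat
  assumes complete: "mcomplete" and dim: "covering_dim_le mtopology m"
    and T: "\<And>i. i < n \<Longrightarrow> isometry (T i)" and T': "\<And>i. i < n \<Longrightarrow> isometry (T' i)"
    and inv: "\<And>i u. i < n \<Longrightarrow> u \<in> M \<Longrightarrow> T i (T' i u) = u"
    and p: "\<And>i. i < n \<Longrightarrow> minimal_point (T i) (p i)" and p': "\<And>i. i < n \<Longrightarrow> minimal_point (T' i) (p i)"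
    and pos: "\<And>i. i < n \<Longrightarrow> 0 < d (p i) (T i (p i))"
    and indep: "\<And>i j u. \<lbrakk>i < n; j < n; i \<noteq> j; u \<in> M\<rbrakk> \<Longrightarrow> busemann (T i) (p i) (T j u) = busemann (T i) (p i) u"
    and indep': "\<And>i j u. \<lbrakk>i < n; j < n; i \<noteq> j; u \<in> M\<rbrakk> \<Longrightarrow> busemann (T' i) (p i) (T j u) = busemann (T' i) (p i) u"
  shows "n \<le> m"
proof -
  obtain x where x: "x \<in> M"
    using CAT0_space by (auto simp: CAT0_space_def)
  define b where "b i = busemann (T i) (p i)" for i
  define b' where "b' i = busemann (T' i) (p i)" for i
  define \<tau> where "\<tau> i = d (p i) (T i (p i))" for i
  have bb': "0 \<le> b i y + b' i y" if "i < n" "y \<in> M" for i y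
    unfolding b_def b'_def using T T' inv p p' that by (intro busemann_inverse_nonneg) auto
  \<comment> \<open>The power must be large enough for translation to open a gap between the levels
    attained on opposite faces.\<close>
  have "\<exists>N::nat. \<forall>i<n. b i x + b' i x < real N * \<tau> i"
  proof -
    have "\<forall>\<^sub>F N in sequentially. b i x + b' i x < real N * \<tau> i" if "i < n" for i
      using pos[OF that] unfolding \<tau>_def by real_asymp
    then have "\<forall>\<^sub>F N in sequentially. \<forall>i\<in>{..<n}. b i x + b' i x < real N * \<tau> i"
      by (intro eventually_ball_finite) auto
    then show ?thesis
      by (auto simp: eventually_sequentially)
  qed
  then obtain N :: nat where N: "\<And>i. i < n \<Longrightarrow> b i x + b' i x < real N * \<tau> i"
    by blast
  define S where "S i = T i ^^ N" for i
  have S: "isometry (S i)" if "i < n" for i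
    unfolding S_def using T[OF that] by (rule isometry_funpow)
  have shift: "f ((T j ^^ k) u) = f u + real k * c"
    if "j < n" "u \<in> M" "\<And>u. u \<in> M \<Longrightarrow> f (T j u) = f u + c" for f c j u and k :: nat
  proof (induction k)
    case (Suc k)
    have "f ((T j ^^ Suc k) u) = f ((T j ^^ k) u) + c"
      using that isometry_in_M[OF isometry_funpow[OF T]] by simp
    then show ?case
      using Suc by (simp add: algebra_simps)
  qed simp
  have bS: "b i (S j u) = b i u + (if i = j then - real N * \<tau> i else 0)" if "i < n" "j < n" "u \<in> M" for i j u
  proof (cases "i = j")
    case True
    then show ?thesis
      using shift[of j u "b i" "- \<tau> i" N] that busemann_translation[OF T p, of i]
      by (simp add: S_def b_def \<tau>_def)
  next
    case False
    then show ?thesis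
      using shift[of j u "b i" 0 N] that indep[of i j] by (simp add: S_def b_def)
  qed
  have b'S: "b' i (S j u) = b' i u" if "i < n" "j < n" "i \<noteq> j" "u \<in> M" for i j u
    using shift[of j u "b' i" 0 N] that indep'[of i j] by (simp add: S_def b'_def)
  have "\<exists>L. \<forall>q r e. 0 \<le> e \<longrightarrow> (\<forall>i<n. 0 \<le> q i \<and> q i \<le> 1) \<longrightarrow> (\<forall>i<n. 0 \<le> r i \<and> r i \<le> 1) \<longrightarrow>
    (\<forall>i<n. \<bar>q i - r i\<bar> \<le> e) \<longrightarrow> d (geo_cube S x n q) (geo_cube S x n r) \<le> L * e"
    by (rule geo_cube_Lipschitz[OF x S])
  then obtain L where L: "\<And>q r e. \<lbrakk>0 \<le> e; \<forall>i<n. 0 \<le> q i \<and> q i \<le> 1; \<forall>i<n. 0 \<le> r i \<and> r i \<le> 1;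
      \<forall>i<n. \<bar>q i - r i\<bar> \<le> e\<rbrakk> \<Longrightarrow> d (geo_cube S x n q) (geo_cube S x n r) \<le> L * e"
    by blast
  \<comment> \<open>The separating function is \<open>- b i\<close>. On the face
    \<open>q i = 1\<close>, convexity of \<open>b i\<close> and its total shift give the upper
    level. On the face \<open>q i = 0\<close>, convexity bounds \<open>b' i\<close>, which dominates
    \<open>- b i\<close>.\<close>
  show ?thesis
  proof (rule covering_dim_ge_if_essential_cube[where f = "geo_cube S x n" and L = L
        and u = "\<lambda>i y. - b i y" and \<alpha> = "\<lambda>i. b' i x" and \<beta> = "\<lambda>i. real N * \<tau> i - b i x", OF complete _ _ _ _ _ _ dim])
    show "continuous_map mtopology euclideanreal (\<lambda>y. - b i y)" if "i < n" for i
      unfolding b_def using continuous_map_busemann[OF T[OF that] p[OF that]]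
      by (intro continuous_map_minus)
    show "b' i x < real N * \<tau> i - b i x" if "i < n" for i
      using N[OF that] by simp
    show "geo_cube S x n q \<in> M" if "q \<in> {q. \<forall>i<n. 0 \<le> q i \<and> q i \<le> 1}" for q
      using that x S by (intro geo_cube_in_M) auto
    show "d (geo_cube S x n q) (geo_cube S x n r) \<le> L * e"
      if "0 \<le> e" "q \<in> {q. \<forall>i<n. 0 \<le> q i \<and> q i \<le> 1}" "r \<in> {q. \<forall>i<n. 0 \<le> q i \<and> q i \<le> 1}"
        "\<And>i. i < n \<Longrightarrow> \<bar>q i - r i\<bar> \<le> e" for q r e
      using that by (intro L) auto
    fix q :: "nat \<Rightarrow> real" and i
    assume "q \<in> {q. \<forall>i<n. 0 \<le> q i \<and> q i \<le> 1}" and i: "i < n"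
    then have q: "\<And>j. j < n \<Longrightarrow> 0 \<le> q j \<and> q j \<le> 1"
      by blast
    have y: "geo_cube S x n q \<in> M"
      using x S q by (intro geo_cube_in_M) auto
    { assume "q i = 1"
      have "b i (geo_cube S x n q) \<le> b i x + (\<Sum>j<n. q j * (if i = j then - real N * \<tau> i else 0))"
        using x S q bS i T p by (intro geo_cube_le) (auto simp: b_def intro!: busemann_convex)
      also have "(\<Sum>j<n. q j * (if i = j then - real N * \<tau> i else 0)) = - real N * \<tau> i"
        using i \<open>q i = 1\<close> by (simp add: if_distrib[of "(*) _"] sum.delta cong: if_cong)
      finally show "real N * \<tau> i - b i x \<le> - b i (geo_cube S x n q)"
        by simp }
    { assume "q i = 0"
      have "b' i (geo_cube S x n q) \<le> b' i x + (\<Sum>j<n. q j * 0)"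
      proof (rule geo_cube_le[OF x S q])
        fix j u
        assume "j < n" "q j \<noteq> 0" "u \<in> M"
        then show "b' i (S j u) = b' i u + 0"
          using b'S[OF i] \<open>q i = 0\<close> by (cases "i = j") auto
      qed (auto simp: b'_def i intro!: busemann_convex T' p')
      then show "- b i (geo_cube S x n q) \<le> b' i x"
        using bb'[OF i y] by simp }
  qed
qed

end

subsection \<open>Commuting elements and characters\<close>

text \<open>A permutation preserves its own support, so a point moved by one element and its image
  are both fixed by the other.\<close>

lemma (in faithful_action) disjoint_supp_commute:
  assumes g: "g \<in> carrier G" and h: "h \<in> carrier G"
    and disj: "supp E \<phi> g \<inter> supp E \<phi> h = {}"
  shows "g \<otimes> h = h \<otimes> g"
proof -
  interpret group G
    using group_hom by (simp add: group_hom_def)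
  have swap: "\<phi> a (\<phi> b x) = \<phi> b (\<phi> a x)"
    if a: "a \<in> carrier G" and b: "b \<in> carrier G" and x: "x \<in> E"
      and ab: "supp E \<phi> a \<inter> supp E \<phi> b = {}" and ax: "\<phi> a x \<noteq> x" for a b x
  proof -
    have axE: "\<phi> a x \<in> E"
      using element_image[OF a x] by simp
    have "\<phi> a (\<phi> a x) \<noteq> \<phi> a x"
      using inj_prop[OF a] axE x ax by (auto dest: inj_onD)
    then have "\<phi> b x = x" "\<phi> b (\<phi> a x) = \<phi> a x"
      using ab x axE ax unfolding supp_def by blast+
    then show ?thesis
      by simp
  qed
  have "\<phi> (g \<otimes> h) x = \<phi> (h \<otimes> g) x" if x: "x \<in> E" for x
  proof -
    have "\<phi> g (\<phi> h x) = \<phi> h (\<phi> g x)"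
    proof (cases "\<phi> g x = x")
      case True
      show ?thesis
      proof (cases "\<phi> h x = x")
        case False
        then show ?thesis
          using swap[OF h g x] disj by (simp add: Int_commute)
      qed (simp add: True)
    qed (rule swap[OF g h x disj])
    then show ?thesis
      by (simp only: composition_rule[OF x g h] composition_rule[OF x h g])
  qed
  \<comment> \<open>Values outside \<open>E\<close> are fixed by convention, so agreement on
    \<open>E\<close> is equality of functions and faithfulness applies.\<close>
  moreover have "\<phi> a \<in> extensional E" if "a \<in> carrier G" for a
    using bij_prop0[OF that] by (simp add: Bij_def)
  ultimately have "\<phi> (g \<otimes> h) = \<phi> (h \<otimes> g)"
    using g h by (intro extensionalityI) auto
  then show ?thesis
    using faithful g h by (auto dest: inj_onD)
qed

lemma (in group_action) supp_conjugate:
  assumes g: "g \<in> carrier G" and h: "h \<in> carrier G"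
  shows "supp E \<phi> (g \<otimes> h \<otimes> inv g) \<subseteq> \<phi> g ` supp E \<phi> h"
proof
  interpret group G
    using group_hom by (simp add: group_hom_def)
  fix a
  assume "a \<in> supp E \<phi> (g \<otimes> h \<otimes> inv g)"
  then have a: "a \<in> E" and ne: "\<phi> (g \<otimes> h \<otimes> inv g) a \<noteq> a"
    by (auto simp: supp_def)
  define b where "b = \<phi> (inv g) a"
  have b: "b \<in> E" "\<phi> g b = a"
    using element_image[OF inv_closed[OF g] a] orbit_sym_aux[OF inv_closed[OF g] a] g
    by (auto simp: b_def)
  have "\<phi> (g \<otimes> h \<otimes> inv g) a = \<phi> g (\<phi> h b)"
    using g h a b(1) by (simp add: composition_rule b_def[symmetric])
  then have "\<phi> h b \<noteq> b"
    using ne b(2) by auto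
  then show "a \<in> \<phi> g ` supp E \<phi> h"
    using b by (auto simp: supp_def)
qed

lemma (in group) commute_inv:
  assumes "x \<in> carrier G" "y \<in> carrier G" "x \<otimes> y = y \<otimes> x"
  shows "x \<otimes> inv y = inv y \<otimes> x"
  using assms by (metis inv_closed inv_solve_left m_assoc m_closed inv_solve_right)

context CAT0
begin

lemma isometric_action_isometry:
  assumes "isometric_action G M d \<psi>" "g \<in> carrier G"
  shows "isometry (\<psi> g)"
  using assms group_action.element_image[of G M \<psi> g]
  by (auto simp: isometry_def isometric_action_def)

text \<open>Each \<open>f k\<close> shifts the Busemann function by a constant, and these constants
  add up to a real character of \<open>K\<close>. The homomorphism \<open>f\<close> lets
  \<open>K\<close> be a subgroup acting either by inclusion or through a conjugate.\<close>

lemma busemann_invariant_if_no_characters: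
  fixes G :: "('g, 'b) monoid_scheme" and K :: "('k, 'c) monoid_scheme"
  assumes act: "isometric_action G M d \<psi>" and t: "t \<in> carrier G"
    and x: "minimal_point (\<psi> t) x" and pos: "0 < d x (\<psi> t x)"
    and f: "f \<in> hom K G" and comm: "\<And>k. k \<in> carrier K \<Longrightarrow> f k \<otimes>\<^bsub>G\<^esub> t = t \<otimes>\<^bsub>G\<^esub> f k"
    and triv: "\<And>\<rho> k. \<lbrakk>\<rho> \<in> hom K real_group; k \<in> carrier K\<rbrakk> \<Longrightarrow> \<rho> k = 0"
    and k: "k \<in> carrier K" and y: "y \<in> M"
  shows "busemann (\<psi> t) x (\<psi> (f k) y) = busemann (\<psi> t) x y"
proof -
  interpret group_action G M \<psi>
    using act by (simp add: isometric_action_def)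
  interpret group G
    using group_hom by (simp add: group_hom_def)
  let ?b = "busemann (\<psi> t) x"
  have xM: "x \<in> M"
    using x by (simp add: minimal_point_def)
  have fk: "f k \<in> carrier G" if "k \<in> carrier K" for k
    using f that by (auto simp: hom_def)
  have im: "\<psi> g u \<in> M" if "g \<in> carrier G" "u \<in> M" for g u
    using element_image that by blast
  have inv_dist: "d (\<psi> g u) v = d u (\<psi> (inv\<^bsub>G\<^esub> g) v)" if "g \<in> carrier G" "u \<in> M" "v \<in> M" for g u v
  proof -
    have "\<psi> g (\<psi> (inv\<^bsub>G\<^esub> g) v) = v"
      using orbit_sym_aux[OF inv_closed[OF that(1)] that(3) refl] that(1) by simp
    then show ?thesis
      using isometry_dist[OF isometric_action_isometry[OF act that(1)] that(2) im[OF inv_closed[OF that(1)] that(3)]]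
      by simp
  qed
  have const: "?b (\<psi> (f k) u) - ?b u = ?b (\<psi> (f k) v) - ?b v"
    if k: "k \<in> carrier K" and "u \<in> M" "v \<in> M" for k u v
  proof (rule busemann_commuting_isometry[where h' = "\<psi> (inv\<^bsub>G\<^esub> f k)",
        OF isometric_action_isometry[OF act t] x pos])
    have "inv\<^bsub>G\<^esub> f k \<otimes>\<^bsub>G\<^esub> t = t \<otimes>\<^bsub>G\<^esub> inv\<^bsub>G\<^esub> f k"
      using commute_inv[OF t fk[OF k]] comm[OF k] by simp
    then show "\<psi> (inv\<^bsub>G\<^esub> f k) (\<psi> t w) = \<psi> t (\<psi> (inv\<^bsub>G\<^esub> f k) w)" if "w \<in> M" for w
      using composition_rule[OF that] t fk[OF k] by (metis inv_closed)
  qed (use that fk im inv_dist in auto)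
  define \<rho> where "\<rho> k = ?b (\<psi> (f k) x) - ?b x" for k
  have "\<rho> (a \<otimes>\<^bsub>K\<^esub> b) = \<rho> a + \<rho> b" if "a \<in> carrier K" "b \<in> carrier K" for a b
  proof -
    have "\<psi> (f (a \<otimes>\<^bsub>K\<^esub> b)) x = \<psi> (f a) (\<psi> (f b) x)"
      using f that composition_rule[OF xM] fk by (simp add: hom_mult)
    then show ?thesis
      using const[OF that(1) im[OF fk[OF that(2)] xM] xM] by (simp add: \<rho>_def)
  qed
  then have "\<rho> \<in> hom K real_group"
    by (simp add: hom_def real_group_def)
  then have "\<rho> k = 0"
    using triv k by blast
  then show ?thesis
    using const[OF k y xM] by (simp add: \<rho>_def)
qed

end

text \<open>An isometry and its inverse displace each point equally far. A common minimal point is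
  what the comparison of their Busemann functions needs.\<close>

lemma semisimple_minimal_point:
  assumes "CAT0 M d" "isometric_action G M d \<psi>" "t \<in> carrier G" "semisimple M d (\<psi> t)"
  obtains x where "CAT0.minimal_point M d (\<psi> t) x" "CAT0.minimal_point M d (\<psi> (inv\<^bsub>G\<^esub> t)) x"
proof -
  interpret CAT0 M d by fact
  interpret group_action G M \<psi>
    using assms(2) by (simp add: isometric_action_def)
  interpret group G
    using group_hom by (simp add: group_hom_def)
  obtain x where x: "x \<in> M" "d x (\<psi> t x) = (INF y\<in>M. d y (\<psi> t y))"
    using assms(4) by (auto simp: semisimple_def translation_length_def)
  have "bdd_below ((\<lambda>y. d y (\<psi> t y)) ` M)"
    by (rule bdd_belowI[of _ 0]) auto
  then have min: "minimal_point (\<psi> t) x"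
    using x by (auto simp: minimal_point_def intro: cINF_lower)
  have "d y (\<psi> (inv\<^bsub>G\<^esub> t) y) = d y (\<psi> t y)" if y: "y \<in> M" for y
  proof -
    have "\<psi> (inv\<^bsub>G\<^esub> t) (\<psi> t y) = y"
      using orbit_sym_aux[OF assms(3) y refl] .
    then show ?thesis
      using isometry_dist[OF isometric_action_isometry[OF assms(2) inv_closed[OF assms(3)]] y, of "\<psi> t y"]
        element_image[OF assms(3) y refl] by (simp add: commute)
  qed
  then have "minimal_point (\<psi> (inv\<^bsub>G\<^esub> t)) x"
    using min by (simp add: minimal_point_def)
  with min show thesis
    using that by blast
qed

section \<open>Commuting conjugates of \<open>s\<close> and the dimension count\<close>

theorem theorem1p1:
  fixes G :: "('g, 'b) monoid_scheme"
    and A :: "'a set" and \<phi> :: "'g \<Rightarrow> 'a \<Rightarrow> 'a"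
    and k :: nat and s :: 'g and H :: "nat \<Rightarrow> 'g set" and g :: "nat \<Rightarrow> 'g"
    and X :: "'x set" and d :: "'x \<Rightarrow> 'x \<Rightarrow> real" and \<psi> :: "'g \<Rightarrow> 'x \<Rightarrow> 'x"
  assumes "group G"
    and "faithful_action G A \<phi>"
    and "s \<in> carrier G"
    and "H 0 = generate G {s}"
    and "H (k + 1) = carrier G"
    and "\<And>i. i \<le> k \<Longrightarrow> subgroup (H i) (G\<lparr>carrier := H (i + 1)\<rparr>)"
    and "\<And>i. 1 \<le> i \<Longrightarrow> i \<le> k \<Longrightarrow> g i \<in> H (i + 1)"
    and "\<And>i f h. \<lbrakk>1 \<le> i; i \<le> k; f \<in> hom (G\<lparr>carrier := H i\<rparr>) real_group; h \<in> H i\<rbrakk> \<Longrightarrow> f h = 0"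
    and "\<And>i. 1 \<le> i \<Longrightarrow> i \<le> k \<Longrightarrow>
           \<phi> (g i) ` supp_set A \<phi> (H i) \<inter> supp_set A \<phi> (H i) = {}"
    and "CAT0_space X d"
    and "Metric_space.mcomplete X d"
    and "covering_dim (Metric_space.mtopology X d) = enat k"
    and "semisimple_action G X d \<psi>"
  shows "\<exists>x\<in>X. \<psi> s x = x"
proof (rule ccontr)
  assume no_fix: "\<not> (\<exists>x\<in>X. \<psi> s x = x)"
  interpret group G by fact
  interpret \<phi>: faithful_action G A \<phi> by fact
  have "Metric_space X d"
    using assms(10) unfolding CAT0_space_def geodesic_space_def by (elim conjE)
  then interpret X: CAT0 X d
    using assms(10) by (intro CAT0.intro CAT0_axioms.intro)
  have act: "isometric_action G X d \<psi>" and ss: "\<And>a. a \<in> carrier G \<Longrightarrow> semisimple X d (\<psi> a)"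
    using assms(13) by (auto simp: semisimple_action_def)
  interpret \<psi>: group_action G X \<psi>
    using act by (simp add: isometric_action_def)

  \<comment> \<open>Each group is given as a subgroup of the next one only, so the induction
    descends from \<open>H (k + 1)\<close>.\<close>
  have HG: "subgroup (H i) G" if "i \<le> k + 1" for i
    using that
  proof (induction rule: inc_induct)
    case base
    show ?case
      using assms(5) subgroup_self by simp
  next
    case (step i)
    then show ?case
      using assms(6)[of i] incl_subgroup[of "H (Suc i)" "H i"] by simp
  qed
  have mono: "H i \<subseteq> H j" if "i \<le> j" "j \<le> k + 1" for i j
    using that
  proof (induction rule: dec_induct)
    case (step j)
    then show ?case
      using subgroup.subset[OF assms(6)[of j]] by auto
  qed simp
  have HGD: "a \<in> carrier G" if "a \<in> H i" "i \<le> k + 1" for a i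
    using subgroup.subset[OF HG[OF that(2)]] that(1) by blast
  have "s \<in> H 0"
    by (simp add: assms(4) generate.incl)
  then have sH: "s \<in> H i" if "i \<le> k + 1" for i
    using mono[of 0 i] that by auto
  have gG: "g i \<in> carrier G" if "1 \<le> i" "i \<le> k" for i
    using assms(7)[OF that] HGD[of "g i" "i + 1"] that by simp
  have conj_commute: "(g i \<otimes>\<^bsub>G\<^esub> b \<otimes>\<^bsub>G\<^esub> inv\<^bsub>G\<^esub> (g i)) \<otimes>\<^bsub>G\<^esub> a = a \<otimes>\<^bsub>G\<^esub> (g i \<otimes>\<^bsub>G\<^esub> b \<otimes>\<^bsub>G\<^esub> inv\<^bsub>G\<^esub> (g i))"
    if i: "1 \<le> i" "i \<le> k" and ab: "a \<in> H i" "b \<in> H i" for i a b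
  proof (rule \<phi>.disjoint_supp_commute)
    have G: "a \<in> carrier G" "b \<in> carrier G"
      using HGD ab i by auto
    then show "a \<in> carrier G" "g i \<otimes>\<^bsub>G\<^esub> b \<otimes>\<^bsub>G\<^esub> inv\<^bsub>G\<^esub> (g i) \<in> carrier G"
      using gG[OF i] by auto
    have "supp A \<phi> (g i \<otimes>\<^bsub>G\<^esub> b \<otimes>\<^bsub>G\<^esub> inv\<^bsub>G\<^esub> (g i)) \<subseteq> \<phi> (g i) ` supp_set A \<phi> (H i)"
      using \<phi>.supp_conjugate[OF gG[OF i] G(2)] ab(2) by (fastforce simp: supp_set_def)
    moreover have "supp A \<phi> a \<subseteq> supp_set A \<phi> (H i)"
      using ab(1) by (auto simp: supp_set_def)
    ultimately show "supp A \<phi> (g i \<otimes>\<^bsub>G\<^esub> b \<otimes>\<^bsub>G\<^esub> inv\<^bsub>G\<^esub> (g i)) \<inter> supp A \<phi> a = {}"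
      using assms(9)[OF i] by blast
  qed

  define t where "t i = (if i = 0 then s else g i \<otimes>\<^bsub>G\<^esub> s \<otimes>\<^bsub>G\<^esub> inv\<^bsub>G\<^esub> (g i))" for i
  \<comment> \<open>Both \<open>g i\<close> and \<open>s\<close> lie in \<open>H (i + 1)\<close>.
    This puts every \<open>t j\<close> with \<open>j < i\<close> into \<open>H i\<close>.\<close>
  have tH: "t i \<in> H (i + 1)" if "i \<le> k" for i
  proof (cases "i = 0")
    case False
    interpret Hi: subgroup "H (Suc i)" G
      using HG that by simp
    show ?thesis
      using False assms(7)[of i] sH[of "i + 1"] that by (simp add: t_def)
  qed (use sH in \<open>simp add: t_def\<close>)
  have tG: "t i \<in> carrier G" if "i \<le> k" for i
    using HGD[OF tH[OF that]] that by simp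
  \<comment> \<open>A fixed point of a conjugate of \<open>s\<close>, carried back by the
    conjugating element, would be fixed by \<open>s\<close>.\<close>
  have t_no_fix: "\<psi> (t i) x \<noteq> x" if i: "i \<le> k" and x: "x \<in> X" for i x
  proof
    assume fix_t: "\<psi> (t i) x = x"
    show False
    proof (cases "i = 0")
      case False
      let ?y = "\<psi> (inv\<^bsub>G\<^esub> (g i)) x"
      have gi: "g i \<in> carrier G"
        using gG False i by simp
      have y: "?y \<in> X"
        using \<psi>.element_image[OF inv_closed[OF gi] x] by simp
      have "inv\<^bsub>G\<^esub> (g i) \<otimes>\<^bsub>G\<^esub> t i = s \<otimes>\<^bsub>G\<^esub> inv\<^bsub>G\<^esub> (g i)"
        using False gi assms(3) by (simp add: t_def m_assoc[symmetric])
      then have "\<psi> s ?y = \<psi> (inv\<^bsub>G\<^esub> (g i)) (\<psi> (t i) x)"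
        using \<psi>.composition_rule[OF x] gi assms(3) tG[OF i] by (metis inv_closed)
      then show False
        using fix_t no_fix y by auto
    qed (use fix_t no_fix x in \<open>auto simp: t_def\<close>)
  qed
  have "\<exists>x. X.minimal_point (\<psi> (t i)) x \<and> X.minimal_point (\<psi> (inv\<^bsub>G\<^esub> (t i))) x" if "i \<le> k" for i
    using semisimple_minimal_point[OF X.CAT0_axioms act tG[OF that] ss[OF tG[OF that]]] by blast
  then obtain p where p: "\<And>i. i \<le> k \<Longrightarrow> X.minimal_point (\<psi> (t i)) (p i)"
    and p': "\<And>i. i \<le> k \<Longrightarrow> X.minimal_point (\<psi> (inv\<^bsub>G\<^esub> (t i))) (p i)"
    by metis
  have pX: "p i \<in> X" if "i \<le> k" for i
    using p[OF that] by (simp add: X.minimal_point_def)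
  \<comment> \<open>The inverse is treated alongside \<open>t i\<close>, since the Busemann
    functions of both directions must be shown invariant.\<close>
  have moves: "0 < d (p i) (\<psi> a (p i))" if i: "i \<le> k" and a: "a = t i \<or> a = inv\<^bsub>G\<^esub> (t i)" for i a
  proof -
    have "\<psi> a (p i) \<noteq> p i"
      using a t_no_fix[OF i pX[OF i]] \<psi>.orbit_sym_aux[OF inv_closed[OF tG[OF i]] pX[OF i]] tG[OF i]
      by auto
    moreover have "\<psi> a (p i) \<in> X"
      using \<psi>.element_image[OF _ pX[OF i] refl] a tG[OF i] by auto
    ultimately show ?thesis
      using X.mdist_pos_less pX[OF i] by metis
  qed

  text \<open>
    If \<open>j < i\<close>, then \<open>t j\<close> lies in \<open>H i\<close>, which centralises \<open>t i\<close>; if \<open>i < j\<close>, then \<open>t j\<close> lies in the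
    conjugate of \<open>H j\<close> by \<open>g j\<close>, which centralises \<open>t i\<close>. Neither group has real characters.
  \<close>
  have invariant: "X.busemann (\<psi> a) (p i) (\<psi> (t j) u) = X.busemann (\<psi> a) (p i) u"
    if i: "i \<le> k" and j: "j \<le> k" and ij: "i \<noteq> j" and u: "u \<in> X" and a: "a = t i \<or> a = inv\<^bsub>G\<^esub> (t i)" for i j u a
  proof -
    have aG: "a \<in> carrier G" and min: "X.minimal_point (\<psi> a) (p i)"
      using a tG p p' i by auto
    have a_comm: "b \<otimes>\<^bsub>G\<^esub> a = a \<otimes>\<^bsub>G\<^esub> b" if "b \<in> carrier G" "b \<otimes>\<^bsub>G\<^esub> t i = t i \<otimes>\<^bsub>G\<^esub> b" for b
      using a that commute_inv[OF that(1) tG[OF i]] by auto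
    consider "j < i" | "i < j"
      using ij by linarith
    then show ?thesis
    proof cases
      case 1
      then have i1: "1 \<le> i"
        by simp
      have "t j \<in> H i"
        using tH[OF j] mono[of "j + 1" i] 1 i by auto
      moreover have "(\<lambda>b. b) \<in> hom (G\<lparr>carrier := H i\<rparr>) G"
        using HGD i by (auto simp: hom_def)
      moreover have "b \<otimes>\<^bsub>G\<^esub> a = a \<otimes>\<^bsub>G\<^esub> b" if "b \<in> H i" for b
      proof (rule a_comm)
        show "b \<otimes>\<^bsub>G\<^esub> t i = t i \<otimes>\<^bsub>G\<^esub> b"
          using conj_commute[OF i1 i that sH] i1 i by (simp add: t_def)
      qed (use HGD that i in auto)
      ultimately show ?thesis
        using assms(8)[OF i1 i] moves[OF i a] u
        by (intro X.busemann_invariant_if_no_characters[OF act aG min, where f = "\<lambda>b. b" and K = "G\<lparr>carrier := H i\<rparr>"])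
          auto
    next
      case 2
      then have j1: "1 \<le> j"
        by simp
      let ?f = "\<lambda>b. g j \<otimes>\<^bsub>G\<^esub> b \<otimes>\<^bsub>G\<^esub> inv\<^bsub>G\<^esub> (g j)"
      have gj: "g j \<in> carrier G"
        using gG[OF j1 j] .
      have ti: "t i \<in> H j"
        using tH[OF i] mono[of "i + 1" j] 2 j by auto
      have "inv\<^bsub>G\<^esub> (g j) \<otimes>\<^bsub>G\<^esub> (g j \<otimes>\<^bsub>G\<^esub> b) = b" if "b \<in> carrier G" for b
        using gj that by (simp add: m_assoc[symmetric])
      then have "?f (b \<otimes>\<^bsub>G\<^esub> c) = ?f b \<otimes>\<^bsub>G\<^esub> ?f c" if "b \<in> carrier G" "c \<in> carrier G" for b c
        using gj that by (simp add: m_assoc)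
      then have "?f \<in> hom (G\<lparr>carrier := H j\<rparr>) G"
        using HGD j gj by (auto simp: hom_def)
      moreover have "?f b \<otimes>\<^bsub>G\<^esub> a = a \<otimes>\<^bsub>G\<^esub> ?f b" if "b \<in> H j" for b
      proof (rule a_comm)
        show "?f b \<otimes>\<^bsub>G\<^esub> t i = t i \<otimes>\<^bsub>G\<^esub> ?f b"
          using conj_commute[OF j1 j ti that] .
      qed (use HGD that j gj in auto)
      ultimately have "X.busemann (\<psi> a) (p i) (\<psi> (?f s) u) = X.busemann (\<psi> a) (p i) u"
        using assms(8)[OF j1 j] moves[OF i a] u sH[of j] j
        by (intro X.busemann_invariant_if_no_characters[OF act aG min, where f = ?f and K = "G\<lparr>carrier := H j\<rparr>"])
          auto
      then show ?thesis
        using j1 by (simp add: t_def)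
    qed
  qed

  \<comment> \<open>The indices run from 0 to \<open>k\<close>, which gives one independent
    translation more than the dimension permits.\<close>
  have "Suc k \<le> k"
  proof (rule X.covering_dim_ge_if_independent_translations[where T = "\<lambda>i. \<psi> (t i)"
        and T' = "\<lambda>i. \<psi> (inv\<^bsub>G\<^esub> (t i))" and p = p])
    show "X.mcomplete" "covering_dim_le X.mtopology k"
      using assms(11) covering_dim_eq_enatD[OF assms(12)] by auto
    show "\<psi> (t i) (\<psi> (inv\<^bsub>G\<^esub> (t i)) u) = u" if "i < Suc k" "u \<in> X" for i u
      using \<psi>.orbit_sym_aux[OF inv_closed[OF tG[of i]] that(2) refl] tG[of i] that(1) by simp
  qed (use p p' moves invariant X.isometric_action_isometry[OF act] tG in auto)
  then show False
    by simp
qed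

end
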